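(* If $\kappa$ is a regular uncountable cardinal, and both $\boxtimes^*(\kappa)$ and $\diamondsuit(\kappa)$ hold, then there exists a $\kappa$-Souslin tree.
   Context: For a set of ordinals $C$, $\operatorname{acc}(C):=\{\alpha\in C\mid \sup(C\cap\alpha)=\alpha>0\}$ is the set of accumulation points of $C$, and $\operatorname{nacc}(C):=C\setminus\operatorname{acc}(C)$. For a regular uncountable cardinal $\kappa$, $\boxtimes^*(\kappa)$ asserts the existence of a sequence $\langle\mathcal C_\alpha\mid\alpha<\kappa\rangle$ such that: (1) for every limit ordinal $\alpha<\kappa$: $\mathcal C_\alpha$ is a nonempty collection of club subsets of $\alpha$, with $|\mathcal C_\alpha|<\kappa$; and if $C\in\mathcal C_\alpha$ and $\bar\alpha$ is an accumulation point of $C$, then $C\cap\bar\alpha\in\mathcal C_{\bar\alpha}$; (2) for every cofinal $A\subseteq\kappa$, there exist stationarily many $\alpha<\kappa$ such that $\sup(\operatorname{nacc}(C)\cap A)=\alpha$ for all $C\in\mathcal C_\alpha$. $\diamondsuit(\kappa)$ asserts the existence of a sequence $\langle Z_\alpha\mid\alpha<\kappa\rangle$ such that for every $Z\subseteq\kappa$ there are stationarily many $\alpha<\kappa$ with $Z\cap\alpha=Z_\alpha$. A tree is a partially ordered set $(T,<_T)$ such that for every $x\in T$ the set $\{y\in T\mid y<_T x\}$ is well-ordered by $<_T$; its order-type is the height $\operatorname{ht}(x)$, and $T_\alpha:=\{x\in T\mid\operatorname{ht}(x)=\alpha\}$. It is a $\kappa$-tree if $\{\alpha\mid T_\alpha\ne\emptyset\}=\kappa$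 and $|T_\alpha|<\kappa$ for all $\alpha<\kappa$. A cofinal branch is a linearly ordered $B\subseteq T$ with $\{\operatorname{ht}(t)\mid t\in B\}=\{\operatorname{ht}(t)\mid t\in T\}$. A $\kappa$-Aronszajn tree is a $\kappa$-tree with no cofinal branches. A $\kappa$-Souslin tree is a $\kappa$-Aronszajn tree with no antichains (sets of pairwise incomparable elements) of size $\kappa$. *)

theory Defs
  imports Main
begin

unbundle cardinal_syntax

text \<open>
  Ordinals are the elements of a type of class \<open>wellorder\<close>: the ordinal \<open>\<alpha>\<close> is identified with
  its initial segment \<open>{..<\<alpha>}\<close>, and the cardinal \<open>\<kappa>\<close> is itself an element of the type.
  \<open>osup A\<close> is the least upper bound of any bounded \<open>A\<close>; in particular \<open>osup {} = ozero\<close>.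
\<close>

definition ozero :: "'a::wellorder" where
  "ozero = (LEAST \<alpha>. True)"

definition osup :: "'a::wellorder set \<Rightarrow> 'a" where
  "osup A = (LEAST \<beta>. \<forall>\<alpha>\<in>A. \<alpha> \<le> \<beta>)"

definition ord_rel :: "'a::wellorder \<Rightarrow> 'a rel" where
  "ord_rel \<kappa> = {(\<alpha>, \<beta>). \<alpha> \<le> \<beta> \<and> \<beta> < \<kappa>}"

definition regular_uncountable :: "'a::wellorder \<Rightarrow> bool" where
  "regular_uncountable \<kappa> \<longleftrightarrow>
     Card_order (ord_rel \<kappa>) \<and> natLeq <o ord_rel \<kappa> \<and> regularCard (ord_rel \<kappa>)"

definition limit_ord :: "'a::wellorder \<Rightarrow> bool" where
  "limit_ord \<alpha> \<longleftrightarrow> ozero < \<alpha> \<and> (\<forall>\<beta><\<alpha>. \<exists>\<gamma><\<alpha>. \<beta> < \<gamma>)"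

definition cofinal_in :: "'a::wellorder \<Rightarrow> 'a set \<Rightarrow> bool" where
  "cofinal_in \<alpha> A \<longleftrightarrow> A \<subseteq> {..<\<alpha>} \<and> (\<forall>\<beta><\<alpha>. \<exists>\<gamma>\<in>A. \<beta> \<le> \<gamma>)"

definition club_in :: "'a::wellorder \<Rightarrow> 'a set \<Rightarrow> bool" where
  "club_in \<alpha> C \<longleftrightarrow> cofinal_in \<alpha> C \<and>
     (\<forall>\<beta><\<alpha>. ozero < \<beta> \<and> osup (C \<inter> {..<\<beta>}) = \<beta> \<longrightarrow> \<beta> \<in> C)"

definition stationary_in :: "'a::wellorder \<Rightarrow> 'a set \<Rightarrow> bool" where
  "stationary_in \<kappa> S \<longleftrightarrow> S \<subseteq> {..<\<kappa>} \<and> (\<forall>D. club_in \<kappa> D \<longrightarrow> S \<inter> D \<noteq> {})"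

definition acc :: "'a::wellorder set \<Rightarrow> 'a set" where
  "acc C = {\<alpha> \<in> C. osup (C \<inter> {..<\<alpha>}) = \<alpha> \<and> ozero < \<alpha>}"

definition nacc :: "'a::wellorder set \<Rightarrow> 'a set" where
  "nacc C = C - acc C"

text \<open>Sequences indexed by the ordinals below \<open>\<kappa>\<close> are functions on the whole type whose values
  at arguments outside \<open>{..<\<kappa>}\<close> are ignored.\<close>

definition boxtimes_star :: "'a::wellorder \<Rightarrow> bool" where
  "boxtimes_star \<kappa> \<longleftrightarrow> (\<exists>\<C> :: 'a \<Rightarrow> 'a set set.
     (\<forall>\<alpha><\<kappa>. limit_ord \<alpha> \<longrightarrow>
        \<C> \<alpha> \<noteq> {} \<and> (\<forall>C\<in>\<C> \<alpha>. club_in \<alpha> C) \<and> |\<C> \<alpha>| <o ord_rel \<kappa> \<and>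
        (\<forall>C\<in>\<C> \<alpha>. \<forall>\<beta>\<in>acc C. C \<inter> {..<\<beta>} \<in> \<C> \<beta>)) \<and>
     (\<forall>A. cofinal_in \<kappa> A \<longrightarrow>
        stationary_in \<kappa> {\<alpha>. \<alpha> < \<kappa> \<and> (\<forall>C\<in>\<C> \<alpha>. osup (nacc C \<inter> A) = \<alpha>)}))"

definition diamond :: "'a::wellorder \<Rightarrow> bool" where
  "diamond \<kappa> \<longleftrightarrow> (\<exists>Z :: 'a \<Rightarrow> 'a set. \<forall>X. X \<subseteq> {..<\<kappa>} \<longrightarrow>
     stationary_in \<kappa> {\<alpha>. \<alpha> < \<kappa> \<and> X \<inter> {..<\<alpha>} = Z \<alpha>})"

text \<open>
  A tree is given by its reflexive order \<open>R\<close>; the underlying set is \<open>Field R\<close>, and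
  \<open>underS R x\<close> is the set of strict predecessors of \<open>x\<close>.
\<close>

definition is_tree :: "'b rel \<Rightarrow> bool" where
  "is_tree R \<longleftrightarrow> Partial_order R \<and>
     (\<forall>x\<in>Field R. well_order_on (underS R x) (Restr R (underS R x)))"

definition has_height :: "'b rel \<Rightarrow> 'b \<Rightarrow> 'a::wellorder \<Rightarrow> bool" where
  "has_height R x \<alpha> \<longleftrightarrow> Restr R (underS R x) =o ord_rel \<alpha>"

definition level :: "'b rel \<Rightarrow> 'a::wellorder \<Rightarrow> 'b set" where
  "level R \<alpha> = {x \<in> Field R. has_height R x \<alpha>}"

text \<open>
  Every node of a \<open>\<kappa>\<close>-tree has a height below \<open>\<kappa>\<close>: the heights occurring in a tree are closed
  downwards, so a node whose predecessors have order type at least \<open>\<kappa>\<close> would make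
  \<open>level R \<kappa>\<close> nonempty.
\<close>

definition kappa_tree :: "'a::wellorder \<Rightarrow> 'b rel \<Rightarrow> bool" where
  "kappa_tree \<kappa> R \<longleftrightarrow> is_tree R \<and>
     {\<alpha>::'a. level R \<alpha> \<noteq> {}} = {..<\<kappa>} \<and>
     (\<forall>\<alpha><\<kappa>. |level R \<alpha>| <o ord_rel \<kappa>)"

text \<open>The ordinal argument \<open>\<kappa>\<close> only serves to fix the type in which heights are taken.\<close>

definition heights :: "'a::wellorder \<Rightarrow> 'b rel \<Rightarrow> 'b set \<Rightarrow> 'a set" where
  "heights \<kappa> R B = {\<alpha>. \<exists>t\<in>B. has_height R t \<alpha>}"

definition cofinal_branch :: "'a::wellorder \<Rightarrow> 'b rel \<Rightarrow> 'b set \<Rightarrow> bool" where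
  "cofinal_branch \<kappa> R B \<longleftrightarrow> B \<subseteq> Field R \<and> B \<in> Chains R \<and>
     heights \<kappa> R B = heights \<kappa> R (Field R)"

definition aronszajn_tree :: "'a::wellorder \<Rightarrow> 'b rel \<Rightarrow> bool" where
  "aronszajn_tree \<kappa> R \<longleftrightarrow> kappa_tree \<kappa> R \<and> (\<nexists>B. cofinal_branch \<kappa> R B)"

definition antichain_in :: "'b rel \<Rightarrow> 'b set \<Rightarrow> bool" where
  "antichain_in R A \<longleftrightarrow> A \<subseteq> Field R \<and>
     (\<forall>x\<in>A. \<forall>y\<in>A. x \<noteq> y \<longrightarrow> (x, y) \<notin> R \<and> (y, x) \<notin> R)"

definition souslin_tree :: "'a::wellorder \<Rightarrow> 'b rel \<Rightarrow> bool" where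
  "souslin_tree \<kappa> R \<longleftrightarrow> aronszajn_tree \<kappa> R \<and>
     (\<nexists>A. antichain_in R A \<and> |A| =o ord_rel \<kappa>)"

end

theory Submission
  imports Defs
begin

text \<open>
  The tree consists of functions from ordinals below \<open>\<kappa>\<close> to \<open>bool\<close>, ordered by extension, and is
  built level by level. At a limit \<open>\<alpha>\<close>, every \<open>C \<in> \<C> \<alpha>\<close> and every earlier node \<open>X\<close> determine a
  canonical branch through \<open>X\<close>: climbing along \<open>C\<close>, at each \<open>\<beta> \<in> nacc C\<close> one moves to a chosen
  extension in level \<open>\<beta>\<close>, above an element of the set guessed by the diamond sequence at \<open>\<beta>\<close> if
  there is one. Coherence of \<open>\<C>\<close> puts the limits of these branches at points of \<open>acc C\<close> into the
  tree, so no branch dies, and \<open>|\<C> \<alpha>| < \<kappa>\<close> keeps the levels small. If \<open>D\<close> is a dense upward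
  closed set of nodes, then the guess at \<open>\<beta>\<close> is \<open>D\<close> restricted to the levels below \<open>\<beta>\<close> for cofinally
  many \<open>\<beta>\<close>, so at some \<open>\<alpha>\<close> every \<open>C \<in> \<C> \<alpha>\<close> has such \<open>\<beta>\<close> cofinally in \<open>nacc C\<close>, and the whole level \<open>\<alpha>\<close>
  lies in \<open>D\<close>. This bounds every antichain.
\<close>


section \<open>Ordinals and regular cardinals\<close>

lemma ozero_le: "ozero \<le> \<alpha>"
  unfolding ozero_def by (simp add: Least_le)

lemma osup_le: "(\<And>\<alpha>. \<alpha> \<in> A \<Longrightarrow> \<alpha> \<le> \<beta>) \<Longrightarrow> osup A \<le> \<beta>"
  unfolding osup_def by (rule Least_le) blast

lemma le_osup:
  assumes "\<And>\<alpha>. \<alpha> \<in> A \<Longrightarrow> \<alpha> \<le> \<beta>" "\<gamma> \<in> A"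
  shows "\<gamma> \<le> osup A"
proof -
  have "\<forall>\<alpha>\<in>A. \<alpha> \<le> osup A"
    unfolding osup_def by (rule LeastI[where k = \<beta>]) (use assms in blast)
  then show ?thesis using assms(2) by blast
qed

lemma less_osupE:
  assumes "\<beta> < osup A"
  obtains \<alpha> where "\<alpha> \<in> A" "\<beta> < \<alpha>"
  using osup_le[of A \<beta>] assms by (meson not_le)

text \<open>\<open>osup {..<\<alpha>} < \<alpha>\<close> is how successor ordinals are recognised
  throughout; the supremum is then the predecessor. It fails at \<open>ozero\<close>, whose supremum
  is \<open>ozero\<close> itself.\<close>

lemma less_iff_le_osup_below:
  assumes "osup {..<\<alpha>} < \<alpha>"
  shows "\<beta> < \<alpha> \<longleftrightarrow> \<beta> \<le> osup {..<\<alpha>}"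
  using assms le_osup[of "{..<\<alpha>}" \<alpha> \<beta>] by fastforce

lemma limit_ord_iff: "limit_ord \<alpha> \<longleftrightarrow> \<alpha> \<noteq> ozero \<and> \<not> osup {..<\<alpha>} < \<alpha>"
proof
  assume l: "limit_ord \<alpha>"
  have "\<not> osup {..<\<alpha>} < \<alpha>"
  proof
    assume "osup {..<\<alpha>} < \<alpha>"
    moreover from this obtain \<gamma> where "\<gamma> < \<alpha>" "osup {..<\<alpha>} < \<gamma>"
      using l unfolding limit_ord_def by blast
    ultimately show False using less_iff_le_osup_below[of \<alpha> \<gamma>] by simp
  qed
  then show "\<alpha> \<noteq> ozero \<and> \<not> osup {..<\<alpha>} < \<alpha>"
    using l unfolding limit_ord_def by auto
next
  assume a: "\<alpha> \<noteq> ozero \<and> \<not> osup {..<\<alpha>} < \<alpha>"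
  have "\<exists>\<gamma><\<alpha>. \<beta> < \<gamma>" if "\<beta> < \<alpha>" for \<beta>
    by (rule less_osupE[of \<beta> "{..<\<alpha>}"]) (use a that in auto)
  moreover have "ozero < \<alpha>" using a ozero_le[of \<alpha>] by (metis le_neq_trans)
  ultimately show "limit_ord \<alpha>" unfolding limit_ord_def by blast
qed

lemma ord_cases:
  obtains "\<alpha> = ozero" | "\<alpha> \<noteq> ozero" "osup {..<\<alpha>} < \<alpha>" | "limit_ord \<alpha>"
  using limit_ord_iff by blast

lemma limit_osupI:
  assumes "\<beta> < \<alpha>" and "\<And>\<gamma>. \<gamma> < \<alpha> \<Longrightarrow> \<exists>\<delta>\<in>A. \<gamma> < \<delta> \<and> \<delta> < \<alpha>"
  shows "limit_ord \<alpha>"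
  unfolding limit_ord_def using assms ozero_le[of \<beta>] by (meson le_less_trans)

lemma limit_ord_acc:
  assumes "\<alpha> \<in> acc C"
  shows "limit_ord \<alpha>"
proof (rule limit_osupI[of ozero])
  show "ozero < \<alpha>" using assms by (simp add: acc_def)
  fix \<gamma> assume "\<gamma> < \<alpha>"
  then have "\<gamma> < osup (C \<inter> {..<\<alpha>})" using assms by (simp add: acc_def)
  then show "\<exists>\<delta>\<in>C. \<gamma> < \<delta> \<and> \<delta> < \<alpha>" by (rule less_osupE) blast
qed

text \<open>Accumulation at \<open>\<gamma>\<close> depends only on the part of the set below
  \<open>\<gamma>\<close>. This makes climbs along \<open>C\<close> and along
  \<open>C \<inter> {..<\<beta>}\<close> comparable.\<close>

lemma nacc_Int_below: "nacc (C \<inter> {..<\<beta>}) = nacc C \<inter> {..<\<beta>}"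
proof -
  have "C \<inter> {..<\<beta>} \<inter> {..<\<gamma>} = C \<inter> {..<\<gamma>}" if "\<gamma> < \<beta>" for \<gamma>
    using that by auto
  then show ?thesis unfolding nacc_def acc_def by auto
qed

lemma nacc_osup_less:
  assumes "\<gamma> \<in> nacc C" "ozero < \<gamma>"
  shows "osup (C \<inter> {..<\<gamma>}) < \<gamma>"
proof -
  have "osup (C \<inter> {..<\<gamma>}) \<le> \<gamma>" by (rule osup_le) auto
  then show ?thesis using assms unfolding nacc_def acc_def by auto
qed

text \<open>The next point of \<open>C\<close> after some \<open>\<delta> \<in> C\<close> is not an
  accumulation point, as all earlier points of \<open>C\<close> are at most
  \<open>\<delta>\<close>.\<close>

lemma club_nacc_cofinal:
  assumes "club_in \<alpha> C" "limit_ord \<alpha>" "\<beta> < \<alpha>"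
  obtains \<gamma> where "\<gamma> \<in> nacc C" "\<beta> < \<gamma>"
proof -
  have above: "\<exists>\<gamma>. \<gamma> \<in> C \<and> \<delta> < \<gamma>" if "\<delta> < \<alpha>" for \<delta>
    using assms(1,2) that unfolding club_in_def cofinal_in_def limit_ord_def
    by (meson less_le_trans)
  obtain \<delta> where d: "\<delta> \<in> C" "\<beta> < \<delta>" using above[OF assms(3)] by blast
  then have "\<delta> < \<alpha>" using assms(1) by (auto simp: club_in_def cofinal_in_def)
  define \<gamma> where "\<gamma> = (LEAST \<gamma>. \<gamma> \<in> C \<and> \<delta> < \<gamma>)"
  have g: "\<gamma> \<in> C" "\<delta> < \<gamma>"
    unfolding \<gamma>_def using LeastI_ex[OF above[OF \<open>\<delta> < \<alpha>\<close>]] by auto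
  have "osup (C \<inter> {..<\<gamma>}) \<le> \<delta>"
  proof (rule osup_le)
    fix \<epsilon> assume "\<epsilon> \<in> C \<inter> {..<\<gamma>}"
    then show "\<epsilon> \<le> \<delta>"
      unfolding \<gamma>_def using not_less_Least by (metis (mono_tags, lifting) IntE lessThan_iff not_le)
  qed
  then have "\<gamma> \<in> nacc C" using g unfolding nacc_def acc_def by auto
  then show thesis using that g d by (meson less_trans)
qed

section \<open>Ordinals as well-order relations\<close>

lemma Field_ord_rel: "Field (ord_rel \<alpha>) = {..<\<alpha>}"
  unfolding ord_rel_def Field_def by auto

lemma Well_order_ord_rel: "Well_order (ord_rel (\<alpha> :: 'a::wellorder))"
proof -
  have "ord_rel \<alpha> - Id \<subseteq> {(x, y). x < y}" unfolding ord_rel_def by auto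
  then have "wf (ord_rel \<alpha> - Id)" using wf wf_subset by blast
  moreover have "Linear_order (ord_rel \<alpha>)"
    unfolding linear_order_on_def partial_order_on_def preorder_on_def refl_on_def trans_def
      antisym_def total_on_def Field_ord_rel by (auto simp: ord_rel_def)
  ultimately show ?thesis unfolding well_order_on_def by blast
qed

lemma underS_ord_rel: "\<alpha> < \<kappa> \<Longrightarrow> underS (ord_rel \<kappa>) \<alpha> = {..<\<alpha>}"
  unfolding underS_def ord_rel_def by auto

lemma Restr_ord_rel: "\<alpha> \<le> \<kappa> \<Longrightarrow> Restr (ord_rel \<kappa>) {..<\<alpha>} = ord_rel \<alpha>"
  unfolding ord_rel_def by auto

lemma ord_rel_less: "\<alpha> < \<beta> \<Longrightarrow> ord_rel \<alpha> <o ord_rel \<beta>"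
  using underS_Restr_ordLess[OF Well_order_ord_rel[of \<beta>]]
  by (metis Field_ord_rel Restr_ord_rel empty_iff lessThan_iff less_imp_le underS_ord_rel)

text \<open>A well-order is not isomorphic to a proper initial segment of itself; this makes the
  height of a node unique.\<close>

lemma ord_rel_inject: "ord_rel \<alpha> =o ord_rel \<beta> \<longleftrightarrow> \<alpha> = \<beta>"
  using ord_rel_less not_ordLess_ordIso ordIso_symmetric ordIso_reflexive Well_order_ord_rel
  by (metis linorder_cases)

section \<open>Consequences of regularity and uncountability\<close>

locale regular =
  fixes \<kappa> :: "'a::wellorder"
  assumes regular: "regular_uncountable \<kappa>"
begin

lemma Card_order_kappa: "Card_order (ord_rel \<kappa>)"
  and natLeq_less_kappa: "natLeq <o ord_rel \<kappa>"
  and regularCard_kappa: "regularCard (ord_rel \<kappa>)"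
  using regular unfolding regular_uncountable_def by auto

lemma infinite_Field: "infinite (Field (ord_rel \<kappa>))"
proof -
  have "natLeq \<le>o |Field (ord_rel \<kappa>)|"
    using natLeq_less_kappa card_of_Field_ordIso[OF Card_order_kappa]
    by (meson ordIso_symmetric ordLess_imp_ordLeq ordLeq_ordIso_trans)
  then show ?thesis using infinite_iff_natLeq_ordLeq by blast
qed

lemma infinite_kappa: "infinite {..<\<kappa>}"
  using infinite_Field by (simp add: Field_ord_rel)

lemma card_below_kappa: "|{..<\<kappa>}| =o ord_rel \<kappa>"
  using card_of_Field_ordIso[OF Card_order_kappa] by (simp add: Field_ord_rel)

lemma card_below_less: "\<alpha> < \<kappa> \<Longrightarrow> |{..<\<alpha>}| <o ord_rel \<kappa>"
  using card_of_underS[OF Card_order_kappa, of \<alpha>] by (simp add: Field_ord_rel underS_ord_rel)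

lemma finite_less: "finite A \<Longrightarrow> |A| <o ord_rel \<kappa>"
  using finite_iff_ordLess_natLeq natLeq_less_kappa ordLess_transitive by blast

lemma UN_less:
  assumes "|I| <o ord_rel \<kappa>" "\<And>i. i \<in> I \<Longrightarrow> |F i| <o ord_rel \<kappa>"
  shows "|\<Union>i\<in>I. F i| <o ord_rel \<kappa>"
  using stable_UNION regularCard_stable Card_order_kappa infinite_Field regularCard_kappa assms
  by blast

text \<open>By regularity, cofinal subsets of \<open>{..<\<kappa>}\<close> have full
  cardinality.\<close>

lemma small_bounded:
  assumes "A \<subseteq> {..<\<kappa>}" "|A| <o ord_rel \<kappa>"
  obtains \<beta> where "\<beta> < \<kappa>" "\<And>\<alpha>. \<alpha> \<in> A \<Longrightarrow> \<alpha> \<le> \<beta>"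
proof -
  have "\<not> cofinal A (ord_rel \<kappa>)"
    using regularCard_kappa assms not_ordLess_ordIso unfolding regularCard_def Field_ord_rel by blast
  then obtain \<beta> where "\<beta> < \<kappa>" "\<forall>\<alpha>\<in>A. \<not> (\<beta> \<noteq> \<alpha> \<and> \<beta> \<le> \<alpha>)"
    using assms(1) unfolding cofinal_def Field_ord_rel by (auto simp: ord_rel_def)
  then show thesis using that by (metis nle_le)
qed

lemma next_below_kappa:
  assumes "\<alpha> < \<kappa>"
  obtains \<beta> where "\<alpha> < \<beta>" "\<beta> < \<kappa>" "osup {..<\<beta>} = \<alpha>"
proof -
  have ex: "\<exists>\<beta>. \<alpha> < \<beta> \<and> \<beta> < \<kappa>"
    using infinite_Card_order_limit[OF Card_order_kappa infinite_Field, of \<alpha>] assms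
    unfolding Field_ord_rel by (auto simp: ord_rel_def dest: le_neq_trans)
  define \<beta> where "\<beta> = (LEAST \<beta>. \<alpha> < \<beta>)"
  have b: "\<alpha> < \<beta>" "\<And>\<gamma>. \<gamma> < \<beta> \<Longrightarrow> \<gamma> \<le> \<alpha>" "\<And>\<gamma>. \<alpha> < \<gamma> \<Longrightarrow> \<beta> \<le> \<gamma>"
    unfolding \<beta>_def using ex by (auto intro: LeastI Least_le dest: not_less_Least)
  then have "\<beta> < \<kappa>" using ex by (meson le_less_trans)
  moreover have "osup {..<\<beta>} = \<alpha>"
    by (rule antisym, rule osup_le, use b in force, rule le_osup[of _ \<alpha>], use b in auto)
  ultimately show thesis using that b by blast
qed

text \<open>A bounding function for \<open>h\<close> is iterated omega times. The supremum of the
  iterates stays below \<open>\<kappa>\<close>, since a countable set has size less than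
  \<open>\<kappa>\<close> and is therefore bounded.\<close>

lemma closure_point_above:
  assumes h: "\<And>\<gamma>. \<gamma> < \<kappa> \<Longrightarrow> h \<gamma> < \<kappa>" and "\<alpha> < \<kappa>"
  obtains \<beta> where "\<alpha> < \<beta>" "\<beta> < \<kappa>" "limit_ord \<beta>" "\<And>\<gamma>. \<gamma> < \<beta> \<Longrightarrow> h \<gamma> < \<beta>"
proof -
  \<comment> \<open>One step must bound \<open>h\<close> on everything up to \<open>\<beta>\<close>,
    since \<open>h\<close> need not be monotone.\<close>
  have "\<exists>\<delta><\<kappa>. \<beta> < \<delta> \<and> (\<forall>\<gamma>\<le>\<beta>. h \<gamma> < \<delta>)" if b: "\<beta> < \<kappa>" for \<beta>
  proof -
    obtain \<beta>' where b': "\<beta> < \<beta>'" "\<beta>' < \<kappa>" using next_below_kappa[OF b] by blast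
    have "|h ` {..<\<beta>'}| <o ord_rel \<kappa>"
      using card_of_image card_below_less[OF b'(2)] ordLeq_ordLess_trans by blast
    moreover have "h ` {..<\<beta>'} \<subseteq> {..<\<kappa>}" using h b' by (auto dest: less_trans)
    ultimately obtain \<delta> where d: "\<delta> < \<kappa>" "\<And>\<epsilon>. \<epsilon> \<in> h ` {..<\<beta>'} \<Longrightarrow> \<epsilon> \<le> \<delta>"
      using small_bounded by blast
    have "max \<delta> \<beta> < \<kappa>" using d b by simp
    then obtain \<epsilon> where "max \<delta> \<beta> < \<epsilon>" "\<epsilon> < \<kappa>" using next_below_kappa by blast
    moreover have "h \<gamma> \<le> \<delta>" if "\<gamma> \<le> \<beta>" for \<gamma>
      using d(2) that b' by (auto dest: le_less_trans)
    ultimately show ?thesis by (intro exI[of _ \<epsilon>]) (auto dest: le_less_trans)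
  qed
  then obtain g where g: "\<And>\<beta>. \<beta> < \<kappa> \<Longrightarrow> g \<beta> < \<kappa> \<and> \<beta> < g \<beta> \<and> (\<forall>\<gamma>\<le>\<beta>. h \<gamma> < g \<beta>)"
    by metis
  define s where "s n = (g ^^ n) \<alpha>" for n :: nat
  have s: "s n < \<kappa>" for n
    unfolding s_def by (induction n) (use g assms in auto)
  have s_Suc: "s n < s (Suc n)" "\<And>\<gamma>. \<gamma> \<le> s n \<Longrightarrow> h \<gamma> < s (Suc n)" for n
    using g[OF s[of n]] by (auto simp: s_def)
  have "|range s| <o ord_rel \<kappa>"
    using card_of_image[of s UNIV] card_of_nat natLeq_less_kappa
    by (meson ordLeq_ordIso_trans ordLeq_ordLess_trans)
  then obtain \<delta> where d: "\<delta> < \<kappa>" "\<And>\<epsilon>. \<epsilon> \<in> range s \<Longrightarrow> \<epsilon> \<le> \<delta>"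
    using small_bounded[of "range s"] s by blast
  let ?\<beta> = "osup (range s)"
  have up: "s n < ?\<beta>" for n
    using s_Suc(1)[of n] le_osup[of "range s" \<delta> "s (Suc n)"] d(2)
    by (meson less_le_trans rangeI)
  have below: "\<exists>n. \<gamma> < s n" if "\<gamma> < ?\<beta>" for \<gamma>
    using less_osupE[OF that] by blast
  show thesis
  proof (rule that[of ?\<beta>])
    show "\<alpha> < ?\<beta>" using up[of 0] by (simp add: s_def)
    show "?\<beta> < \<kappa>" using osup_le[of "range s" \<delta>] d by (meson le_less_trans)
    show "limit_ord ?\<beta>"
      using below up by (intro limit_osupI[of "s 0" _ "range s"]) auto
    show "h \<gamma> < ?\<beta>" if "\<gamma> < ?\<beta>" for \<gamma>
      using below[OF that] s_Suc(2) up by (meson less_imp_le less_trans)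
  qed
qed

text \<open>The limit closure points of \<open>h\<close> above \<open>\<alpha>\<close> form a club.
  With \<open>h\<close> the identity, the lemma just yields limit elements of \<open>S\<close> above
  \<open>\<alpha>\<close>.\<close>

lemma stationary_closure_point:
  assumes "stationary_in \<kappa> S" and h: "\<And>\<gamma>. \<gamma> < \<kappa> \<Longrightarrow> h \<gamma> < \<kappa>" and "\<alpha> < \<kappa>"
  obtains \<beta> where "\<beta> \<in> S" "\<alpha> < \<beta>" "\<beta> < \<kappa>" "limit_ord \<beta>" "\<And>\<gamma>. \<gamma> < \<beta> \<Longrightarrow> h \<gamma> < \<beta>"
proof -
  define D where "D = {\<beta>. \<alpha> < \<beta> \<and> \<beta> < \<kappa> \<and> limit_ord \<beta> \<and> (\<forall>\<gamma><\<beta>. h \<gamma> < \<beta>)}"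
  have "club_in \<kappa> D"
    unfolding club_in_def
  proof (intro conjI allI impI)
    show "cofinal_in \<kappa> D"
      unfolding cofinal_in_def
    proof (intro conjI allI impI)
      show "D \<subseteq> {..<\<kappa>}" unfolding D_def by auto
      fix \<beta> assume "\<beta> < \<kappa>"
      then have "max \<alpha> \<beta> < \<kappa>" using assms by simp
      then obtain \<delta> where "max \<alpha> \<beta> < \<delta>" "\<delta> < \<kappa>" "limit_ord \<delta>" "\<And>\<gamma>. \<gamma> < \<delta> \<Longrightarrow> h \<gamma> < \<delta>"
        using closure_point_above[of h "max \<alpha> \<beta>"] h by blast
      then have "max \<alpha> \<beta> < \<delta>" "\<delta> \<in> D" unfolding D_def by auto
      then show "\<exists>\<gamma>\<in>D. \<beta> \<le> \<gamma>" by (auto intro: less_imp_le)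
    qed
    fix \<beta> assume b: "\<beta> < \<kappa>" "ozero < \<beta> \<and> osup (D \<inter> {..<\<beta>}) = \<beta>"
    have below: "\<exists>\<delta>\<in>D. \<gamma> < \<delta> \<and> \<delta> < \<beta>" if "\<gamma> < \<beta>" for \<gamma>
      by (rule less_osupE[of \<gamma> "D \<inter> {..<\<beta>}"]) (use b that in auto)
    then have "limit_ord \<beta>" using b by (intro limit_osupI[of ozero _ D]) auto
    moreover have "h \<gamma> < \<beta>" if "\<gamma> < \<beta>" for \<gamma>
      using below[OF that] unfolding D_def by (auto dest: less_trans)
    moreover have "\<alpha> < \<beta>" using below[of ozero] b unfolding D_def by (auto dest: less_trans)
    ultimately show "\<beta> \<in> D" using b unfolding D_def by blast
  qed
  then obtain \<beta> where "\<beta> \<in> S" "\<beta> \<in> D" using assms(1) unfolding stationary_in_def by blast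
  then show thesis using that unfolding D_def by blast
qed

end


section \<open>Nodes and levels\<close>

text \<open>A node of height \<open>\<alpha>\<close> is the graph of a function \<open>{..<\<alpha>} \<Rightarrow> bool\<close>, so that the tree order is
  inclusion and limits are unions.\<close>

definition node :: "'a::wellorder \<Rightarrow> ('a \<times> bool) set \<Rightarrow> bool" where
  "node \<alpha> X \<longleftrightarrow> single_valued X \<and> Domain X = {..<\<alpha>}"

definition below :: "'a::wellorder \<Rightarrow> ('a \<times> bool) set \<Rightarrow> ('a \<times> bool) set" where
  "below \<gamma> X = X \<inter> ({..<\<gamma>} \<times> UNIV)"

lemma below_below: "\<gamma> \<le> \<delta> \<Longrightarrow> below \<gamma> (below \<delta> X) = below \<gamma> X"
  unfolding below_def by auto

lemma below_subset: "below \<gamma> X \<subseteq> X"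
  unfolding below_def by auto

lemma node_below: "node \<alpha> X \<Longrightarrow> \<gamma> \<le> \<alpha> \<Longrightarrow> node \<gamma> (below \<gamma> X)"
  unfolding node_def below_def single_valued_def by (auto simp: Domain_iff set_eq_iff)

lemma node_unique: "node \<alpha> X \<Longrightarrow> node \<beta> X \<Longrightarrow> \<alpha> = \<beta>"
  unfolding node_def by (metis lessThan_eq_iff)

lemma node_subset_le: "node \<alpha> X \<Longrightarrow> node \<beta> Y \<Longrightarrow> X \<subseteq> Y \<Longrightarrow> \<alpha> \<le> \<beta>"
  unfolding node_def by (metis Domain_mono lessThan_subset_iff)

text \<open>\<open>X\<close> is total on \<open>{..<\<alpha>}\<close> and \<open>Y\<close> is
  single-valued, so \<open>Y\<close> has no further pairs there. Thus the tree predecessors of a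
  node can only be its restrictions.\<close>

lemma node_subset_below:
  assumes "node \<alpha> X" "node \<beta> Y" "X \<subseteq> Y"
  shows "X = below \<alpha> Y"
proof
  show "X \<subseteq> below \<alpha> Y" using assms unfolding node_def below_def by auto
  show "below \<alpha> Y \<subseteq> X"
  proof (clarsimp simp: below_def)
    fix \<gamma> b assume y: "(\<gamma>, b) \<in> Y" "\<gamma> < \<alpha>"
    then obtain c where "(\<gamma>, c) \<in> X" using assms(1) unfolding node_def by blast
    with y assms show "(\<gamma>, b) \<in> X" unfolding node_def single_valued_def by blast
  qed
qed

lemma node_below_self: "node \<alpha> X \<Longrightarrow> below \<alpha> X = X"
  using node_subset_below by blast

lemma node_insert:
  assumes "osup {..<\<alpha>} < \<alpha>" "node (osup {..<\<alpha>}) Y"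
  shows "node \<alpha> (insert (osup {..<\<alpha>}, b) Y)"
  using assms less_iff_le_osup_below[OF assms(1)]
  unfolding node_def single_valued_def by (auto simp: le_less)

lemma node_Union_chain:
  assumes I: "I \<subseteq> {..<\<alpha>}" "\<And>\<delta>. \<delta> < \<alpha> \<Longrightarrow> \<exists>\<gamma>\<in>I. \<delta> < \<gamma>"
    and P: "\<And>\<gamma>. \<gamma> \<in> I \<Longrightarrow> node \<gamma> (P \<gamma>)"
    and mono: "\<And>\<gamma> \<delta>. \<gamma> \<in> I \<Longrightarrow> \<delta> \<in> I \<Longrightarrow> \<gamma> < \<delta> \<Longrightarrow> P \<gamma> \<subseteq> P \<delta>"
  shows "node \<alpha> (\<Union>\<gamma>\<in>I. P \<gamma>)"
  unfolding node_def
proof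
  have "P \<gamma> \<subseteq> P \<delta> \<or> P \<delta> \<subseteq> P \<gamma>" if "\<gamma> \<in> I" "\<delta> \<in> I" for \<gamma> \<delta>
    using mono[of \<gamma> \<delta>] mono[of \<delta> \<gamma>] that by (cases \<gamma> \<delta> rule: linorder_cases) auto
  then show "single_valued (\<Union>\<gamma>\<in>I. P \<gamma>)"
    using P unfolding node_def single_valued_def by (smt (verit) UN_E subsetD)
  have "Domain (\<Union>\<gamma>\<in>I. P \<gamma>) = (\<Union>\<gamma>\<in>I. {..<\<gamma>})"
    using P unfolding node_def by (auto simp: Domain_Union)
  also have "\<dots> = {..<\<alpha>}" using I by (auto dest: less_trans)
  finally show "Domain (\<Union>\<gamma>\<in>I. P \<gamma>) = {..<\<alpha>}" .
qed

text \<open>As the choice depends on the arguments only, branches built along coherent clubs cohere.\<close>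

definition pick :: "'n set set \<Rightarrow> 'n set set \<Rightarrow> 'n set \<Rightarrow> 'n set" where
  "pick S W Y = (SOME V. V \<in> S \<and> Y \<subseteq> V \<and>
     ((\<exists>V'\<in>S. \<exists>a\<in>W. Y \<union> a \<subseteq> V') \<longrightarrow> (\<exists>a\<in>W. a \<subseteq> V)))"

text \<open>The description under \<open>SOME\<close> is satisfiable: take a member of
  \<open>S\<close> above \<open>Y\<close> and an element of \<open>W\<close> if there is one, and
  \<open>V\<close> otherwise.\<close>

lemma pick:
  assumes "V \<in> S" "Y \<subseteq> V"
  shows "pick S W Y \<in> S" "Y \<subseteq> pick S W Y"
    "V' \<in> S \<Longrightarrow> a \<in> W \<Longrightarrow> Y \<union> a \<subseteq> V' \<Longrightarrow> \<exists>a\<in>W. a \<subseteq> pick S W Y"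
proof -
  have "\<exists>V. V \<in> S \<and> Y \<subseteq> V \<and> ((\<exists>V'\<in>S. \<exists>a\<in>W. Y \<union> a \<subseteq> V') \<longrightarrow> (\<exists>a\<in>W. a \<subseteq> V))"
    using assms by (metis Un_subset_iff)
  from someI_ex[OF this, folded pick_def]
  show "pick S W Y \<in> S" "Y \<subseteq> pick S W Y"
    "V' \<in> S \<Longrightarrow> a \<in> W \<Longrightarrow> Y \<union> a \<subseteq> V' \<Longrightarrow> \<exists>a\<in>W. a \<subseteq> pick S W Y"
    by blast+
qed

text \<open>Here \<open>E\<close> is the part of \<open>nacc C\<close> above the height of the node \<open>X\<close>. Points of \<open>acc C\<close> need no step:
  at such a \<open>\<beta>\<close> the union is already the limit node belonging to \<open>C \<inter> {..<\<beta>}\<close>.\<close>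

function climb :: "('a::wellorder \<Rightarrow> 'n set \<Rightarrow> 'n set) \<Rightarrow> 'a set \<Rightarrow> 'n set \<Rightarrow> 'a \<Rightarrow> 'n set" where
  "climb p E X \<beta> = X \<union> (\<Union>\<gamma>\<in>E \<inter> {..<\<beta>}. p \<gamma> (climb p E X \<gamma>))"
  by auto
termination
  by (relation "inv_image {(\<gamma>, \<beta>). \<gamma> < \<beta>} (\<lambda>(p, E, X, \<beta>). \<beta>)") (auto intro: wf)

declare climb.simps [simp del]

text \<open>The recursion at \<open>\<beta>\<close> looks only at points below
  \<open>\<beta>\<close>. This removes the termination test from \<open>lev\<close> and transfers
  climbs between coherent clubs.\<close>

lemma climb_cong:
  assumes "\<And>\<gamma>. \<gamma> < \<beta> \<Longrightarrow> \<gamma> \<in> E \<longleftrightarrow> \<gamma> \<in> E'" "\<And>\<gamma>. \<gamma> < \<beta> \<Longrightarrow> \<gamma> \<in> E \<Longrightarrow> p \<gamma> = p' \<gamma>"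
  shows "climb p E X \<beta> = climb p' E' X \<beta>"
  using assms
proof (induction \<beta> rule: less_induct)
  case (less \<beta>)
  have "climb p E X \<gamma> = climb p' E' X \<gamma>" if "\<gamma> < \<beta>" for \<gamma>
    using less that by (meson less_trans)
  moreover have "E \<inter> {..<\<beta>} = E' \<inter> {..<\<beta>}" using less.prems by auto
  ultimately show ?case
    unfolding climb.simps[of _ _ _ \<beta>] using less.prems by (intro arg_cong2[of _ _ _ _ "(\<union>)"] SUP_cong) auto
qed

lemma climb_subset: "X \<subseteq> climb p E X \<beta>"
  by (subst climb.simps) auto

lemma climb_eq_base: "E \<inter> {..<\<beta>} = {} \<Longrightarrow> climb p E X \<beta> = X"
  by (subst climb.simps) auto

lemma climb_step: "\<gamma> \<in> E \<Longrightarrow> \<gamma> < \<beta> \<Longrightarrow> p \<gamma> (climb p E X \<gamma>) \<subseteq> climb p E X \<beta>"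
  by (subst (2) climb.simps) auto

lemma climb_eq_step:
  assumes "E \<inter> {..<\<beta>} = insert \<gamma> (E \<inter> {..<\<gamma>})"
  shows "climb p E X \<beta> = climb p E X \<gamma> \<union> p \<gamma> (climb p E X \<gamma>)"
  unfolding climb.simps[of p E X \<beta>] assms using climb.simps[of p E X \<gamma>] by auto

lemma climb_eq: "E \<inter> {..<\<beta>} = E \<inter> {..<\<gamma>} \<Longrightarrow> climb p E X \<beta> = climb p E X \<gamma>"
  unfolding climb.simps[of p E X \<beta>] climb.simps[of p E X \<gamma>] by simp

text \<open>The test \<open>\<gamma> < \<alpha>\<close> only serves termination; see \<open>T_limit\<close> below.\<close>

function lev :: "('a::wellorder \<Rightarrow> 'a set set) \<Rightarrow> ('a \<Rightarrow> ('a \<times> bool) set set) \<Rightarrow> 'a \<Rightarrow>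
    ('a \<times> bool) set set" where
  "lev \<C> \<Omega> \<alpha> =
    (if \<alpha> = ozero then {{}}
     else if osup {..<\<alpha>} < \<alpha> then
       (\<Union>b. insert (osup {..<\<alpha>}, b) ` lev \<C> \<Omega> (osup {..<\<alpha>}))
     else (\<Union>C\<in>\<C> \<alpha>. \<Union>\<xi>\<in>{..<\<alpha>}.
       (\<lambda>X. climb (\<lambda>\<gamma>. pick (if \<gamma> < \<alpha> then lev \<C> \<Omega> \<gamma> else {}) (\<Omega> \<gamma>)) (nacc C \<inter> {\<xi><..}) X \<alpha>)
         ` lev \<C> \<Omega> \<xi>))"
  by auto
termination
  by (relation "inv_image {(\<gamma>, \<beta>). \<gamma> < \<beta>} (\<lambda>(\<C>, \<Omega>, \<beta>). \<beta>)") (auto intro: wf)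

declare lev.simps [simp del]

section \<open>Properties of the levels for an arbitrary family of guesses
  \<open>\<Omega>\<close>\<close>

locale levels = regular \<kappa> for \<kappa> :: "'a::wellorder" +
  fixes \<C> :: "'a \<Rightarrow> 'a set set" and \<Omega> :: "'a \<Rightarrow> ('a \<times> bool) set set"
  assumes C_nonempty: "\<alpha> < \<kappa> \<Longrightarrow> limit_ord \<alpha> \<Longrightarrow> \<C> \<alpha> \<noteq> {}"
    and C_club: "\<alpha> < \<kappa> \<Longrightarrow> limit_ord \<alpha> \<Longrightarrow> C \<in> \<C> \<alpha> \<Longrightarrow> club_in \<alpha> C"
    and C_small: "\<alpha> < \<kappa> \<Longrightarrow> limit_ord \<alpha> \<Longrightarrow> |\<C> \<alpha>| <o ord_rel \<kappa>"
    and C_coherent: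
      "\<alpha> < \<kappa> \<Longrightarrow> limit_ord \<alpha> \<Longrightarrow> C \<in> \<C> \<alpha> \<Longrightarrow> \<beta> \<in> acc C \<Longrightarrow> C \<inter> {..<\<beta>} \<in> \<C> \<beta>"
begin

abbreviation T :: "'a \<Rightarrow> ('a \<times> bool) set set" where
  "T \<equiv> lev \<C> \<Omega>"

abbreviation step :: "'a \<Rightarrow> ('a \<times> bool) set \<Rightarrow> ('a \<times> bool) set" where
  "step \<gamma> \<equiv> pick (T \<gamma>) (\<Omega> \<gamma>)"

lemma T_zero: "T ozero = {{}}"
  by (subst lev.simps) simp

lemma T_succ:
  assumes "osup {..<\<alpha>} < \<alpha>"
  shows "T \<alpha> = (\<Union>b. insert (osup {..<\<alpha>}, b) ` T (osup {..<\<alpha>}))"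
proof -
  have "\<alpha> \<noteq> ozero" using assms ozero_le[of "osup {..<\<alpha>}"] by auto
  then show ?thesis using assms by (subst lev.simps) simp
qed

lemma T_limit:
  assumes "limit_ord \<alpha>"
  shows "T \<alpha> = (\<Union>C\<in>\<C> \<alpha>. \<Union>\<xi>\<in>{..<\<alpha>}. (\<lambda>X. climb step (nacc C \<inter> {\<xi><..}) X \<alpha>) ` T \<xi>)"
proof -
  have "climb (\<lambda>\<gamma>. pick (if \<gamma> < \<alpha> then T \<gamma> else {}) (\<Omega> \<gamma>)) E X \<alpha> = climb step E X \<alpha>" for E X
    by (rule climb_cong) auto
  then show ?thesis using assms by (subst lev.simps) (simp add: limit_ord_iff)
qed

text \<open>The invariant of the construction. Its last clause guarantees that \<open>pick\<close>
  always has candidates.\<close>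

definition normal :: "'a \<Rightarrow> bool" where
  "normal \<alpha> \<longleftrightarrow> (\<forall>X\<in>T \<alpha>. node \<alpha> X \<and> (\<forall>\<gamma><\<alpha>. below \<gamma> X \<in> T \<gamma>)) \<and>
     (\<forall>\<xi><\<alpha>. \<forall>X\<in>T \<xi>. \<exists>Y\<in>T \<alpha>. X \<subseteq> Y)"

text \<open>Here coherence keeps branches alive. The node reached before the stop
  \<open>\<gamma>\<close> is decided by the last point \<open>\<eta>\<close> of \<open>C\<close>
  below \<open>\<gamma>\<close>. If \<open>\<eta> \<in> acc C\<close>, it is a limit node for the
  club \<open>C \<inter> {..<\<eta>} \<in> \<C> \<eta>\<close>; otherwise it was picked from
  \<open>T \<eta>\<close>. If \<open>C\<close> has no point between \<open>\<xi>\<close> and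
  \<open>\<gamma>\<close>, it is still \<open>X\<close>.\<close>

lemma climb_previous:
  assumes \<alpha>: "\<alpha> < \<kappa>" "limit_ord \<alpha>" and C: "C \<in> \<C> \<alpha>"
    and normal: "\<And>\<beta>. \<beta> < \<alpha> \<Longrightarrow> normal \<beta>"
    and X: "X \<in> T \<xi>" and \<gamma>: "\<gamma> \<in> nacc C \<inter> {\<xi><..}"
  defines "E \<equiv> nacc C \<inter> {\<xi><..}"
  shows "\<exists>\<eta><\<gamma>. climb step E X \<gamma> \<in> T \<eta>"
  using \<gamma>
proof (induction \<gamma> rule: less_induct)
  case (less \<gamma>)
  note club = C_club[OF \<alpha> C]
  then have sub: "C \<subseteq> {..<\<alpha>}" unfolding club_in_def cofinal_in_def by blast
  have \<gamma>: "\<gamma> \<in> nacc C" "\<xi> < \<gamma>" using less.prems by auto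
  then have "\<gamma> < \<alpha>" using sub unfolding nacc_def by blast
  have "ozero < \<gamma>" using \<gamma> ozero_le by (meson le_less_trans)
  show ?case
  proof (cases "C \<inter> {..<\<gamma>} \<inter> {\<xi><..} = {}")
    case True
    then have "E \<inter> {..<\<gamma>} = {}" unfolding E_def nacc_def by blast
    then show ?thesis using X \<gamma> by (auto simp: climb_eq_base)
  next
    case False
    \<comment> \<open>As \<open>\<gamma>\<close> is not an accumulation point, \<open>\<eta>\<close>
      lies strictly below it; closedness of \<open>C\<close> will make \<open>\<eta>\<close> the
      largest point of \<open>C\<close> below \<open>\<gamma>\<close>.\<close>
    define \<eta> where "\<eta> = osup (C \<inter> {..<\<gamma>})"
    have "\<eta> < \<gamma>" unfolding \<eta>_def by (rule nacc_osup_less[OF \<gamma>(1) \<open>ozero < \<gamma>\<close>])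
    have max: "\<delta> \<le> \<eta>" if "\<delta> \<in> C" "\<delta> < \<gamma>" for \<delta>
      unfolding \<eta>_def by (rule le_osup[of _ \<gamma>]) (use that in auto)
    have "\<xi> < \<eta>" using False max by (auto dest: less_le_trans)
    have "\<eta> \<in> C"
    proof (rule ccontr)
      assume "\<eta> \<notin> C"
      then have "C \<inter> {..<\<gamma>} = C \<inter> {..<\<eta>}"
        using max \<open>\<eta> < \<gamma>\<close> by (auto dest: le_neq_trans)
      then have "osup (C \<inter> {..<\<eta>}) = \<eta>" unfolding \<eta>_def by simp
      moreover have "ozero < \<eta>" using \<open>\<xi> < \<eta>\<close> ozero_le by (meson le_less_trans)
      moreover have "\<eta> < \<alpha>" using \<open>\<eta> < \<gamma>\<close> \<open>\<gamma> < \<alpha>\<close> by simp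
      ultimately show False using club \<open>\<eta> \<notin> C\<close> unfolding club_in_def by blast
    qed
    show ?thesis
    proof (cases "\<eta> \<in> acc C")
      case True
      then have "\<eta> \<notin> E" unfolding E_def nacc_def by blast
      then have "E \<inter> {..<\<gamma>} = E \<inter> {..<\<eta>}"
        using max \<open>\<eta> < \<gamma>\<close> unfolding E_def nacc_def by (auto simp: le_less)
      then have "climb step E X \<gamma> = climb step E X \<eta>" by (rule climb_eq)
      also have "\<dots> = climb step (nacc (C \<inter> {..<\<eta>}) \<inter> {\<xi><..}) X \<eta>"
        unfolding E_def nacc_Int_below by (rule climb_cong) auto
      also have "\<dots> \<in> T \<eta>"
        using T_limit[OF limit_ord_acc[OF True]] C_coherent[OF \<alpha> C True] X \<open>\<xi> < \<eta>\<close> by blast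
      finally show ?thesis using \<open>\<eta> < \<gamma>\<close> by blast
    next
      case False
      then have \<eta>: "\<eta> \<in> nacc C \<inter> {\<xi><..}" using \<open>\<eta> \<in> C\<close> \<open>\<xi> < \<eta>\<close> unfolding nacc_def by blast
      then have "E \<inter> {..<\<gamma>} = insert \<eta> (E \<inter> {..<\<eta>})"
        using max \<open>\<eta> < \<gamma>\<close> unfolding E_def nacc_def by (auto simp: le_less)
      then have eq: "climb step E X \<gamma> = climb step E X \<eta> \<union> step \<eta> (climb step E X \<eta>)"
        by (rule climb_eq_step)
      obtain \<zeta> where "\<zeta> < \<eta>" "climb step E X \<eta> \<in> T \<zeta>"
        using less.IH[OF \<open>\<eta> < \<gamma>\<close> \<eta>] by blast
      moreover have "normal \<eta>" using normal \<open>\<eta> < \<gamma>\<close> \<open>\<gamma> < \<alpha>\<close> by (meson less_trans)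
      ultimately obtain V where "V \<in> T \<eta>" "climb step E X \<eta> \<subseteq> V" unfolding normal_def by blast
      \<comment> \<open>The picked node contains the node it extends, so the union in
        \<open>eq\<close> is the picked node itself.\<close>
      from pick(1,2)[OF this] show ?thesis
        using \<open>\<eta> < \<gamma>\<close> unfolding eq by (auto simp: Un_absorb1)
    qed
  qed
qed

text \<open>\<open>climb_previous\<close> places the node reached before \<open>\<gamma>\<close> in
  an earlier level, so normality at \<open>\<gamma>\<close> supplies the extension that
  \<open>pick\<close> requires.\<close>

lemma climb_pick:
  assumes \<alpha>: "\<alpha> < \<kappa>" "limit_ord \<alpha>" and C: "C \<in> \<C> \<alpha>"
    and normal: "\<And>\<beta>. \<beta> < \<alpha> \<Longrightarrow> normal \<beta>"
    and X: "X \<in> T \<xi>" and \<gamma>: "\<gamma> \<in> nacc C \<inter> {\<xi><..}"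
  defines "E \<equiv> nacc C \<inter> {\<xi><..}"
  shows "step \<gamma> (climb step E X \<gamma>) \<in> T \<gamma>" "climb step E X \<gamma> \<subseteq> step \<gamma> (climb step E X \<gamma>)"
proof -
  have "\<gamma> < \<alpha>"
    using C_club[OF \<alpha> C] \<gamma> unfolding club_in_def cofinal_in_def nacc_def by blast
  obtain \<eta> where "\<eta> < \<gamma>" "climb step E X \<gamma> \<in> T \<eta>"
    using climb_previous[OF assms(1-6)] unfolding E_def by blast
  then obtain V where "V \<in> T \<gamma>" "climb step E X \<gamma> \<subseteq> V"
    using normal[OF \<open>\<gamma> < \<alpha>\<close>] unfolding normal_def by blast
  from pick(1,2)[OF this]
  show "step \<gamma> (climb step E X \<gamma>) \<in> T \<gamma>" "climb step E X \<gamma> \<subseteq> step \<gamma> (climb step E X \<gamma>)" .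
qed

text \<open>The picked nodes \<open>P \<gamma>\<close> form a chain with heights cofinal in
  \<open>\<alpha>\<close>. Their union is a node, and each proper restriction of it is a restriction
  of some \<open>P \<delta>\<close>, hence in the tree by normality at
  \<open>\<delta>\<close>.\<close>

lemma climb_limit:
  assumes \<alpha>: "\<alpha> < \<kappa>" "limit_ord \<alpha>" and C: "C \<in> \<C> \<alpha>"
    and normal: "\<And>\<beta>. \<beta> < \<alpha> \<Longrightarrow> normal \<beta>"
    and X: "X \<in> T \<xi>" "\<xi> < \<alpha>"
  defines "U \<equiv> climb step (nacc C \<inter> {\<xi><..}) X \<alpha>"
  shows "node \<alpha> U" "\<gamma> < \<alpha> \<Longrightarrow> below \<gamma> U \<in> T \<gamma>"
proof -
  define E where "E = nacc C \<inter> {\<xi><..}"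
  define P where "P \<gamma> = step \<gamma> (climb step E X \<gamma>)" for \<gamma>
  have E: "E \<subseteq> {..<\<alpha>}"
    using C_club[OF \<alpha> C] unfolding club_in_def cofinal_in_def E_def nacc_def by blast
  have cof: "\<exists>\<delta>\<in>E. \<gamma> < \<delta>" if "\<gamma> < \<alpha>" for \<gamma>
    using club_nacc_cofinal[OF C_club[OF \<alpha> C] \<alpha>(2), of "max \<gamma> \<xi>"] that X
    unfolding E_def by (metis IntI greaterThan_iff max_less_iff_conj)
  have P: "P \<gamma> \<in> T \<gamma>" "climb step E X \<gamma> \<subseteq> P \<gamma>" if "\<gamma> \<in> E" for \<gamma>
    using climb_pick[OF \<alpha> C normal X(1)] that unfolding P_def E_def by blast+
  have nP: "node \<gamma> (P \<gamma>)" if "\<gamma> \<in> E" for \<gamma>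
    using P[OF that] normal[of \<gamma>] that E unfolding normal_def by blast
  have mono: "P \<gamma> \<subseteq> P \<delta>" if "\<gamma> \<in> E" "\<delta> \<in> E" "\<gamma> < \<delta>" for \<gamma> \<delta>
    using climb_step[of \<gamma> E \<delta> step X] that P unfolding P_def by blast
  obtain \<zeta> where "\<zeta> \<in> E" using cof[OF X(2)] by blast
  \<comment> \<open>Every picked node absorbs the base \<open>X\<close>, so \<open>U\<close> is the
    union of the chain alone.\<close>
  then have "X \<subseteq> (\<Union>\<gamma>\<in>E. P \<gamma>)"
    using P(2) climb_subset[of X step E \<zeta>] by blast
  then have U: "U = (\<Union>\<gamma>\<in>E. P \<gamma>)"
    unfolding U_def E_def[symmetric] climb.simps[of _ _ _ \<alpha>] P_def using E by blast
  show node: "node \<alpha> U"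
    unfolding U using E cof nP mono by (rule node_Union_chain)
  show "below \<gamma> U \<in> T \<gamma>" if "\<gamma> < \<alpha>"
  proof -
    obtain \<delta> where \<delta>: "\<delta> \<in> E" "\<gamma> < \<delta>" using cof \<open>\<gamma> < \<alpha>\<close> by blast
    then have "P \<delta> = below \<delta> U"
      using node_subset_below[OF nP[OF \<delta>(1)] node] U by blast
    then have "below \<gamma> U = below \<gamma> (P \<delta>)" using \<delta> by (simp add: below_below)
    then show ?thesis
      using P(1)[OF \<delta>(1)] normal[of \<delta>] \<delta> E unfolding normal_def by auto
  qed
qed

text \<open>At a limit, nodes are handled by \<open>climb_limit\<close>, and climbing from
  \<open>X\<close> along any member of the nonempty \<open>\<C> \<alpha>\<close> extends
  \<open>X\<close>.\<close>

lemma normal: "\<alpha> < \<kappa> \<Longrightarrow> normal \<alpha>"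
proof (induction \<alpha> rule: less_induct)
  case (less \<alpha>)
  show ?case
  proof (cases \<alpha> rule: ord_cases)
    case 1
    moreover have "\<not> \<gamma> < ozero" for \<gamma> :: 'a using ozero_le[of \<gamma>] by simp
    ultimately show ?thesis by (auto simp: normal_def T_zero node_def single_valued_def)
  next
    case 2
    define \<pi> where "\<pi> = osup {..<\<alpha>}"
    have \<pi>: "\<pi> < \<alpha>" using 2 by (simp add: \<pi>_def)
    have le: "\<gamma> \<le> \<pi>" and cases: "\<gamma> < \<pi> \<or> \<gamma> = \<pi>" if "\<gamma> < \<alpha>" for \<gamma>
      using less_iff_le_osup_below[OF 2(2), of \<gamma>] that unfolding \<pi>_def by (auto simp: le_less)
    have T: "T \<alpha> = (\<Union>b. insert (\<pi>, b) ` T \<pi>)" unfolding \<pi>_def by (rule T_succ) fact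
    have n: "normal \<pi>" using less \<pi> by simp
    show ?thesis
      unfolding normal_def
    proof (intro conjI ballI allI impI)
      fix X assume "X \<in> T \<alpha>"
      then obtain b Y where X: "X = insert (\<pi>, b) Y" "Y \<in> T \<pi>" unfolding T by blast
      then have Y: "node \<pi> Y" using n unfolding normal_def by blast
      then show "node \<alpha> X" unfolding X(1) \<pi>_def by (intro node_insert 2)
      fix \<gamma> assume "\<gamma> < \<alpha>"
      then have "below \<gamma> X = below \<gamma> Y" using le[OF \<open>\<gamma> < \<alpha>\<close>] unfolding X below_def by auto
      then show "below \<gamma> X \<in> T \<gamma>"
        using cases[OF \<open>\<gamma> < \<alpha>\<close>] X(2) n node_below_self[OF Y] unfolding normal_def by metis
    next
      fix \<xi> X assume "\<xi> < \<alpha>" "X \<in> T \<xi>"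
      then obtain Y where "Y \<in> T \<pi>" "X \<subseteq> Y"
        using n cases[of \<xi>] unfolding normal_def by blast
      then show "\<exists>Y\<in>T \<alpha>. X \<subseteq> Y" unfolding T by blast
    qed
  next
    case 3
    have IH: "normal \<beta>" if "\<beta> < \<alpha>" for \<beta> using less that by simp
    show ?thesis
      unfolding normal_def
    proof (intro conjI ballI allI impI)
      fix X assume "X \<in> T \<alpha>"
      then obtain C \<xi> Y where Y: "C \<in> \<C> \<alpha>" "\<xi> < \<alpha>" "Y \<in> T \<xi>"
        "X = climb step (nacc C \<inter> {\<xi><..}) Y \<alpha>"
        unfolding T_limit[OF 3] by blast
      note lim = climb_limit[OF less.prems 3 Y(1) IH Y(3,2), folded Y(4)]
      show "node \<alpha> X" by (rule lim(1))
      show "below \<gamma> X \<in> T \<gamma>" if "\<gamma> < \<alpha>" for \<gamma> using lim(2) that by blast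
    next
      fix \<xi> X assume X: "\<xi> < \<alpha>" "X \<in> T \<xi>"
      obtain C where "C \<in> \<C> \<alpha>" using C_nonempty[OF less.prems 3] by blast
      then have "climb step (nacc C \<inter> {\<xi><..}) X \<alpha> \<in> T \<alpha>" using X unfolding T_limit[OF 3] by blast
      then show "\<exists>Y\<in>T \<alpha>. X \<subseteq> Y"
        using climb_subset[of X step "nacc C \<inter> {\<xi><..}" \<alpha>] by blast
    qed
  qed
qed

lemma T_node: "\<alpha> < \<kappa> \<Longrightarrow> X \<in> T \<alpha> \<Longrightarrow> node \<alpha> X"
  using normal unfolding normal_def by blast

lemma T_below: "\<alpha> < \<kappa> \<Longrightarrow> X \<in> T \<alpha> \<Longrightarrow> \<gamma> \<le> \<alpha> \<Longrightarrow> below \<gamma> X \<in> T \<gamma>"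
  using normal[of \<alpha>] node_below_self[of \<alpha> X] unfolding normal_def
  by (metis order_le_less)

lemma T_extend: "\<alpha> < \<kappa> \<Longrightarrow> \<xi> \<le> \<alpha> \<Longrightarrow> X \<in> T \<xi> \<Longrightarrow> \<exists>Y\<in>T \<alpha>. X \<subseteq> Y"
  using normal[of \<alpha>] unfolding normal_def by (metis order_le_less order_refl)

lemma T_nonempty: "\<alpha> < \<kappa> \<Longrightarrow> T \<alpha> \<noteq> {}"
  using T_extend[of \<alpha> ozero "{}"] ozero_le T_zero by blast

text \<open>A limit level is indexed by a club in \<open>\<C> \<alpha>\<close>, a height
  \<open>\<xi> < \<alpha>\<close> and a node of \<open>T \<xi>\<close>; regularity keeps such unions
  small.\<close>

lemma T_small: "\<alpha> < \<kappa> \<Longrightarrow> |T \<alpha>| <o ord_rel \<kappa>"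
proof (induction \<alpha> rule: less_induct)
  case (less \<alpha>)
  have image: "|f ` A| <o ord_rel \<kappa>" if "|A| <o ord_rel \<kappa>" for f :: "_ \<Rightarrow> ('a \<times> bool) set" and A :: "('a \<times> bool) set set"
    using that card_of_image ordLeq_ordLess_trans by blast
  show ?case
  proof (cases \<alpha> rule: ord_cases)
    case 1
    then show ?thesis by (simp add: T_zero finite_less)
  next
    case 2
    have "|T (osup {..<\<alpha>})| <o ord_rel \<kappa>" using less 2 by simp
    then show ?thesis unfolding T_succ[OF 2(2)] by (intro UN_less image) (auto intro: finite_less)
  next
    case 3
    show ?thesis
      unfolding T_limit[OF 3]
      by (intro UN_less image C_small card_below_less less.IH less.prems 3)
        (use less.prems in auto)
  qed
qed

text \<open>\<open>Y\<close> arises by climbing along a single \<open>C\<close>, so one stop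
  \<open>\<beta> \<in> nacc C \<inter> B\<close> above the base is enough: there
  \<open>dense\<close> offers a guessed node above the branch built so far, and the picked node must
  contain a guessed one.\<close>

lemma T_limit_meets:
  assumes \<alpha>: "\<alpha> < \<kappa>" "limit_ord \<alpha>" and B: "\<And>C. C \<in> \<C> \<alpha> \<Longrightarrow> osup (nacc C \<inter> B) = \<alpha>"
    and dense: "\<And>\<beta> \<eta> X. \<beta> \<in> B \<Longrightarrow> \<beta> < \<alpha> \<Longrightarrow> \<eta> < \<beta> \<Longrightarrow> X \<in> T \<eta> \<Longrightarrow>
      \<exists>\<delta>\<le>\<beta>. \<exists>a\<in>T \<delta> \<inter> \<Omega> \<beta>. X \<subseteq> a"
    and Y: "Y \<in> T \<alpha>"
  shows "\<exists>\<beta>\<in>B. \<exists>a\<in>\<Omega> \<beta>. a \<subseteq> Y"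
proof -
  obtain C \<xi> X where X: "C \<in> \<C> \<alpha>" "\<xi> < \<alpha>" "X \<in> T \<xi>"
    "Y = climb step (nacc C \<inter> {\<xi><..}) X \<alpha>"
    using Y unfolding T_limit[OF \<alpha>(2)] by blast
  define E where "E = nacc C \<inter> {\<xi><..}"
  have n: "normal \<beta>" if "\<beta> < \<alpha>" for \<beta> using that \<alpha> by (intro normal) simp
  have "\<xi> < osup (nacc C \<inter> B)" using B X by simp
  then obtain \<beta> where \<beta>: "\<beta> \<in> nacc C \<inter> B" "\<xi> < \<beta>" by (rule less_osupE)
  then have "\<beta> \<in> E" by (simp add: E_def)
  have "\<beta> < \<alpha>"
    using C_club[OF \<alpha> X(1)] \<beta> unfolding club_in_def cofinal_in_def nacc_def by blast
  then have "\<beta> < \<kappa>" using \<alpha> by simp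
  obtain \<eta> where \<eta>: "\<eta> < \<beta>" "climb step E X \<beta> \<in> T \<eta>"
    using climb_previous[OF \<alpha> X(1) n X(3)] \<beta> unfolding E_def by blast
  then obtain \<delta> a where a: "\<delta> \<le> \<beta>" "a \<in> T \<delta>" "a \<in> \<Omega> \<beta>" "climb step E X \<beta> \<subseteq> a"
    using dense[of \<beta>] \<beta> \<open>\<beta> < \<alpha>\<close> by blast
  \<comment> \<open>Candidates for \<open>pick\<close> come from \<open>T \<beta>\<close>, so the
    guessed \<open>a\<close>, of height \<open>\<delta> \<le> \<beta>\<close>, is first extended to
    that level.\<close>
  then obtain V where V: "V \<in> T \<beta>" "a \<subseteq> V" using T_extend[OF \<open>\<beta> < \<kappa>\<close>] by blast
  then have sub: "climb step E X \<beta> \<subseteq> V" "climb step E X \<beta> \<union> a \<subseteq> V" using a by auto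
  \<comment> \<open>The picked node need not contain \<open>a\<close> itself, only some guessed node
    \<open>a'\<close>.\<close>
  obtain a' where "a' \<in> \<Omega> \<beta>" "a' \<subseteq> step \<beta> (climb step E X \<beta>)"
    using pick(3)[OF V(1) sub(1) V(1) a(3) sub(2)] by blast
  moreover have "step \<beta> (climb step E X \<beta>) \<subseteq> Y"
    unfolding X(4) E_def[symmetric] by (rule climb_step) fact+
  ultimately show ?thesis using \<beta> by blast
qed

end


section \<open>The Souslin tree\<close>

text \<open>Diamond leaves only \<open>\<kappa>\<close> many bounded subsets of
  \<open>\<kappa>\<close>: a subset of \<open>\<alpha>\<close> reappears as some
  \<open>Z \<beta>\<close> with \<open>\<beta> > \<alpha>\<close>. A node is coded by its height and
  such a \<open>\<beta>\<close>, and pairs below \<open>\<kappa>\<close> by single ordinals. Through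
  the codes, guesses of sets of ordinals become guesses of sets of nodes.\<close>

lemma (in regular) node_coding:
  assumes Z: "\<And>X. X \<subseteq> {..<\<kappa>} \<Longrightarrow> stationary_in \<kappa> {\<alpha>. \<alpha> < \<kappa> \<and> X \<inter> {..<\<alpha>} = Z \<alpha>}"
  obtains e :: "('a \<times> bool) set \<Rightarrow> 'a" where "inj_on e {X. \<exists>\<alpha><\<kappa>. node \<alpha> X}"
    "\<And>\<alpha> X. \<alpha> < \<kappa> \<Longrightarrow> node \<alpha> X \<Longrightarrow> e X < \<kappa>"
proof -
  let ?N = "{X. \<exists>\<alpha><\<kappa>. node \<alpha> X}"
  define code where "code X p \<longleftrightarrow> p \<in> {..<\<kappa>} \<times> {..<\<kappa>} \<and> node (fst p) X \<and> {\<gamma>. (\<gamma>, True) \<in> X} = Z (snd p)"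
    for X p
  have ex: "\<exists>p. code X p" if "X \<in> ?N" for X
  proof -
    from that obtain \<alpha> where \<alpha>: "\<alpha> < \<kappa>" "node \<alpha> X" by blast
    let ?S = "{\<gamma>. (\<gamma>, True) \<in> X}"
    have S: "?S \<subseteq> {..<\<alpha>}" using \<alpha>(2) unfolding node_def by blast
    then have "stationary_in \<kappa> {\<beta>. \<beta> < \<kappa> \<and> ?S \<inter> {..<\<beta>} = Z \<beta>}"
      using \<alpha> by (intro Z) auto
    then obtain \<beta> where "\<beta> < \<kappa>" "?S \<inter> {..<\<beta>} = Z \<beta>" "\<alpha> < \<beta>"
      using stationary_closure_point[of _ "\<lambda>\<gamma>. \<gamma>"] \<alpha>(1) by blast
    moreover from this have "?S \<inter> {..<\<beta>} = ?S"
      by (intro Int_absorb2 order_trans[OF S]) simp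
    ultimately show ?thesis
      using \<alpha> by (intro exI[of _ "(\<alpha>, \<beta>)"]) (simp add: code_def)
  qed
  then obtain g where g: "\<And>X. X \<in> ?N \<Longrightarrow> code X (g X)" by metis
  \<comment> \<open>A common code fixes the height and the set of arguments with value
    \<open>True\<close>, hence the function; one inclusion is enough by symmetry.\<close>
  have "X \<subseteq> Y" if codes: "code X p" "code Y p" for X Y p
  proof (clarify)
    fix \<gamma> b assume x: "(\<gamma>, b) \<in> X"
    then obtain c where y: "(\<gamma>, c) \<in> Y" using codes unfolding code_def node_def by blast
    have tr: "(\<gamma>, True) \<in> X \<longleftrightarrow> (\<gamma>, True) \<in> Y" using codes unfolding code_def by blast
    have "single_valued X" using codes unfolding code_def node_def by blast
    then have "c \<Longrightarrow> b" using x y tr single_valuedD[of X \<gamma> b True] by auto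
    then show "(\<gamma>, b) \<in> Y" using x y tr by (cases b; cases c) auto
  qed
  then have "inj_on g ?N" using g by (intro inj_onI) (metis subset_antisym)
  moreover obtain f where f: "bij_betw f ({..<\<kappa>} \<times> {..<\<kappa>}) {..<\<kappa>}"
    using card_of_Times_same_infinite[OF infinite_kappa] card_of_ordIso by blast
  moreover have g_mem: "g ` ?N \<subseteq> {..<\<kappa>} \<times> {..<\<kappa>}" using g unfolding code_def by blast
  ultimately have "inj_on (f \<circ> g) ?N"
    by (meson bij_betw_def comp_inj_on inj_on_subset)
  moreover have "(f \<circ> g) X < \<kappa>" if "\<alpha> < \<kappa>" "node \<alpha> X" for \<alpha> X
    using that g_mem bij_betw_apply[OF f] by (auto simp: image_subset_iff)
  ultimately show thesis using that by blast
qed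

text \<open>\<open>\<Omega> \<beta>\<close> decodes \<open>Z \<beta>\<close>. It is restricted to
  nodes because \<open>e\<close> is known to be injective only on them.\<close>

locale coded_levels = levels \<kappa> \<C> \<Omega>
  for \<kappa> :: "'a::wellorder" and \<C> :: "'a \<Rightarrow> 'a set set" and \<Omega> :: "'a \<Rightarrow> ('a \<times> bool) set set" +
  fixes Z :: "'a \<Rightarrow> 'a set" and e :: "('a \<times> bool) set \<Rightarrow> 'a"
  assumes hits: "cofinal_in \<kappa> A \<Longrightarrow>
      stationary_in \<kappa> {\<alpha>. \<alpha> < \<kappa> \<and> (\<forall>C\<in>\<C> \<alpha>. osup (nacc C \<inter> A) = \<alpha>)}"
    and guesses: "S \<subseteq> {..<\<kappa>} \<Longrightarrow> stationary_in \<kappa> {\<alpha>. \<alpha> < \<kappa> \<and> S \<inter> {..<\<alpha>} = Z \<alpha>}"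
    and e_inj: "inj_on e {X. \<exists>\<alpha><\<kappa>. node \<alpha> X}"
    and e_less: "\<alpha> < \<kappa> \<Longrightarrow> node \<alpha> X \<Longrightarrow> e X < \<kappa>"
    and \<Omega>: "\<Omega> \<beta> = {X. (\<exists>\<alpha><\<kappa>. node \<alpha> X) \<and> e X \<in> Z \<beta>}"
begin

section \<open>The tree on codes and its heights\<close>

definition Tree :: "('a \<times> bool) set set" where
  "Tree = (\<Union>\<alpha>\<in>{..<\<kappa>}. T \<alpha>)"

text \<open>The order is carried over from nodes to codes, so that the tree lives on the type of
  ordinals.\<close>

definition R :: "'a rel" where
  "R = {(e X, e Y) | X Y. X \<in> Tree \<and> Y \<in> Tree \<and> X \<subseteq> Y}"

lemma TreeE:
  assumes "X \<in> Tree"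
  obtains \<alpha> where "\<alpha> < \<kappa>" "X \<in> T \<alpha>" "node \<alpha> X"
  using assms T_node unfolding Tree_def by blast

lemma TreeI: "\<alpha> < \<kappa> \<Longrightarrow> X \<in> T \<alpha> \<Longrightarrow> X \<in> Tree"
  unfolding Tree_def by blast

lemma e_inj_Tree: "inj_on e Tree"
  using e_inj by (rule inj_on_subset) (use TreeE in blast)

lemma e_eq: "X \<in> Tree \<Longrightarrow> Y \<in> Tree \<Longrightarrow> e X = e Y \<longleftrightarrow> X = Y"
  using e_inj_Tree by (simp add: inj_on_eq_iff)

lemma R_iff: "X \<in> Tree \<Longrightarrow> Y \<in> Tree \<Longrightarrow> (e X, e Y) \<in> R \<longleftrightarrow> X \<subseteq> Y"
  unfolding R_def by (auto simp: e_eq)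

lemma Field_R: "Field R = e ` Tree"
  unfolding R_def Field_def by auto

lemma Partial_order_R: "Partial_order R"
  unfolding partial_order_on_def preorder_on_def
proof (intro conjI)
  show "refl_on (Field R) R" unfolding refl_on_def Field_R by (auto simp: R_iff)
  show "R \<subseteq> Field R \<times> Field R" unfolding Field_def by auto
  show "trans R" unfolding trans_def R_def by (auto simp: e_eq) blast
  show "antisym R" unfolding antisym_def R_def by (auto simp: e_eq)
qed

text \<open>The predecessors of a node are its proper restrictions, one for each
  \<open>\<gamma> < \<alpha>\<close> and in the same order. This identifies tree height with level
  index.\<close>

lemma
  assumes \<alpha>: "\<alpha> < \<kappa>" and X: "X \<in> T \<alpha>"
  shows underS_R: "underS R (e X) = (\<lambda>\<gamma>. e (below \<gamma> X)) ` {..<\<alpha>}" (is "_ = ?f ` _")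
    and inj_below: "inj_on (\<lambda>\<gamma>. e (below \<gamma> X)) {..<\<alpha>}"
    and Restr_underS_R:
      "Restr R (underS R (e X)) = dir_image (ord_rel \<alpha>) (\<lambda>\<gamma>. e (below \<gamma> X))"
proof -
  have nX: "node \<alpha> X" using T_node \<alpha> X by blast
  have XT: "X \<in> Tree" using TreeI \<alpha> X by blast
  have b: "below \<gamma> X \<in> Tree" "node \<gamma> (below \<gamma> X)" if "\<gamma> < \<alpha>" for \<gamma>
    using T_below[OF \<alpha> X, of \<gamma>] node_below[OF nX, of \<gamma>] TreeI[of \<gamma>] that \<alpha> by auto
  have b_iff: "below \<gamma> X \<subseteq> below \<delta> X \<longleftrightarrow> \<gamma> \<le> \<delta>" if "\<gamma> < \<alpha>" "\<delta> < \<alpha>" for \<gamma> \<delta>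
    using node_subset_le b(2) that by (metis below_below below_subset)
  show inj: "inj_on ?f {..<\<alpha>}"
    using b(1) b_iff by (intro inj_onI) (metis antisym e_eq lessThan_iff order_refl)
  show eq: "underS R (e X) = ?f ` {..<\<alpha>}"
  proof (intro equalityI subsetI)
    fix y assume "y \<in> underS R (e X)"
    then obtain Y where Y: "Y \<in> Tree" "Y \<subseteq> X" "Y \<noteq> X" "y = e Y"
      using XT unfolding underS_def R_def by (auto simp: e_eq)
    obtain \<gamma> where \<gamma>: "node \<gamma> Y" using TreeE Y(1) by blast
    then have "Y = below \<gamma> X" "\<gamma> \<le> \<alpha>"
      using node_subset_below node_subset_le nX Y(2) by blast+
    moreover from this have "\<gamma> \<noteq> \<alpha>" using Y(3) node_below_self[OF nX] by auto
    ultimately show "y \<in> ?f ` {..<\<alpha>}" using Y(4) by auto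
  next
    fix y assume "y \<in> ?f ` {..<\<alpha>}"
    then obtain \<gamma> where \<gamma>: "\<gamma> < \<alpha>" "y = e (below \<gamma> X)" by blast
    have "below \<gamma> X \<noteq> X"
      using node_unique[OF nX, of \<gamma>] b(2)[OF \<gamma>(1)] \<gamma>(1) by auto
    then show "y \<in> underS R (e X)"
      unfolding underS_def using \<gamma> b(1) XT by (simp add: R_iff e_eq below_subset)
  qed
  show "Restr R (underS R (e X)) = dir_image (ord_rel \<alpha>) ?f"
  proof -
    have "(\<gamma>, \<delta>) \<in> ord_rel \<alpha> \<longleftrightarrow> \<gamma> < \<alpha> \<and> \<delta> < \<alpha> \<and> (?f \<gamma>, ?f \<delta>) \<in> R" for \<gamma> \<delta>
    proof (cases "\<gamma> < \<alpha> \<and> \<delta> < \<alpha>")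
      case True
      then show ?thesis using b(1) b_iff unfolding ord_rel_def by (simp add: R_iff)
    qed (auto simp: ord_rel_def)
    then have "dir_image (ord_rel \<alpha>) ?f = {(?f \<gamma>, ?f \<delta>) | \<gamma> \<delta>. \<gamma> < \<alpha> \<and> \<delta> < \<alpha> \<and> (?f \<gamma>, ?f \<delta>) \<in> R}"
      unfolding dir_image_def by simp
    also have "\<dots> = Restr R (underS R (e X))" unfolding eq by auto
    finally show ?thesis by simp
  qed
qed

lemma has_height_R:
  assumes \<alpha>: "\<alpha> < \<kappa>" and X: "X \<in> T \<alpha>"
  shows "has_height R (e X) \<beta> \<longleftrightarrow> \<beta> = \<alpha>"
proof -
  have "ord_rel \<alpha> =o Restr R (underS R (e X))"
    unfolding Restr_underS_R[OF \<alpha> X]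
    by (intro dir_image_ordIso Well_order_ord_rel) (simp add: Field_ord_rel inj_below[OF \<alpha> X])
  then show ?thesis
    unfolding has_height_def
    by (metis ord_rel_inject ordIso_symmetric ordIso_transitive)
qed

lemma level_R: "level R \<alpha> = (if \<alpha> < \<kappa> then e ` T \<alpha> else {})"
  unfolding level_def Field_R using has_height_R TreeI by (auto elim!: TreeE)

lemma kappa_tree_R: "kappa_tree \<kappa> R"
  unfolding kappa_tree_def is_tree_def
proof (intro conjI ballI allI impI)
  show "Partial_order R" by (rule Partial_order_R)
  fix x assume "x \<in> Field R"
  then obtain \<alpha> X where X: "\<alpha> < \<kappa>" "X \<in> T \<alpha>" "x = e X" unfolding Field_R by (auto elim: TreeE)
  have "Well_order (Restr R (underS R x))"
    unfolding X(3) Restr_underS_R[OF X(1,2)]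
    by (intro Well_order_dir_image Well_order_ord_rel) (simp add: Field_ord_rel inj_below[OF X(1,2)])
  moreover have "Field (Restr R (underS R x)) = underS R x"
    unfolding X(3) by (subst Restr_underS_R[OF X(1,2)])
      (simp only: dir_image_Field Field_ord_rel underS_R[OF X(1,2)])
  ultimately show "well_order_on (underS R x) (Restr R (underS R x))" by simp
next
  show "{\<alpha>. level R \<alpha> \<noteq> {}} = {..<\<kappa>}" using T_nonempty by (auto simp: level_R)
  show "|level R \<alpha>| <o ord_rel \<kappa>" if "\<alpha> < \<kappa>" for \<alpha>
    using T_small[OF that] that card_of_image ordLeq_ordLess_trans by (simp add: level_R) blast
qed

section \<open>Dense sets, antichains and branches\<close>

text \<open>\<open>T \<gamma>\<close> is small, so regularity bounds all chosen extensions at once.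
  Codes are bounded along with heights because a correct guess at \<open>\<beta>\<close> contains
  only codes below \<open>\<beta>\<close>.\<close>

lemma dense_bound:
  assumes D: "D \<subseteq> Tree" "\<And>X. X \<in> Tree \<Longrightarrow> \<exists>Y\<in>D. X \<subseteq> Y" and "\<gamma> < \<kappa>"
  obtains \<beta> where "\<beta> < \<kappa>" "\<And>X. X \<in> T \<gamma> \<Longrightarrow> \<exists>\<delta>\<le>\<beta>. \<exists>Y\<in>D \<inter> T \<delta>. X \<subseteq> Y \<and> e Y \<le> \<beta>"
proof -
  have "\<exists>\<beta><\<kappa>. \<exists>\<delta>\<le>\<beta>. \<exists>Y\<in>D \<inter> T \<delta>. X \<subseteq> Y \<and> e Y \<le> \<beta>" if "X \<in> T \<gamma>" for X
  proof -
    obtain Y where Y: "Y \<in> D" "X \<subseteq> Y" using D(2)[OF TreeI[OF assms(3) \<open>X \<in> T \<gamma>\<close>]] by blast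
    then obtain \<delta> where \<delta>: "\<delta> < \<kappa>" "Y \<in> T \<delta>" "node \<delta> Y" using D(1) TreeE by blast
    show ?thesis
    proof (rule exI[of _ "max \<delta> (e Y)"], rule conjI)
      show "max \<delta> (e Y) < \<kappa>" using e_less \<delta> by simp
      show "\<exists>\<delta>'\<le>max \<delta> (e Y). \<exists>Y'\<in>D \<inter> T \<delta>'. X \<subseteq> Y' \<and> e Y' \<le> max \<delta> (e Y)"
        using Y \<delta> by (meson IntI max.cobounded1 max.cobounded2)
    qed
  qed
  then obtain b where b: "\<And>X. X \<in> T \<gamma> \<Longrightarrow> b X < \<kappa> \<and> (\<exists>\<delta>\<le>b X. \<exists>Y\<in>D \<inter> T \<delta>. X \<subseteq> Y \<and> e Y \<le> b X)"
    by metis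
  have "|b ` T \<gamma>| <o ord_rel \<kappa>"
    using T_small[OF assms(3)] card_of_image ordLeq_ordLess_trans by blast
  moreover have "b ` T \<gamma> \<subseteq> {..<\<kappa>}" using b by blast
  ultimately obtain \<beta> where \<beta>: "\<beta> < \<kappa>" "\<And>\<alpha>. \<alpha> \<in> b ` T \<gamma> \<Longrightarrow> \<alpha> \<le> \<beta>"
    using small_bounded by blast
  show thesis
  proof (rule that[OF \<beta>(1)])
    fix X assume "X \<in> T \<gamma>"
    then show "\<exists>\<delta>\<le>\<beta>. \<exists>Y\<in>D \<inter> T \<delta>. X \<subseteq> Y \<and> e Y \<le> \<beta>"
      using b[of X] \<beta>(2)[of "b X"] by (meson imageI order_trans)
  qed
qed

text \<open>Let \<open>h\<close> bound extensions into \<open>D\<close> level by level. Diamond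
  makes the set \<open>B\<close> of closure points of \<open>h\<close> with a correct guess of
  \<open>D\<close> cofinal; boxtimes gives a limit \<open>\<alpha>\<close> where every club in
  \<open>\<C> \<alpha>\<close> has cofinally many non-accumulation points in \<open>B\<close>, and
  \<open>T_limit_meets\<close> applies.\<close>

lemma dense_contains_level:
  assumes D: "D \<subseteq> Tree" "\<And>X. X \<in> Tree \<Longrightarrow> \<exists>Y\<in>D. X \<subseteq> Y"
    and up: "\<And>X Y. X \<in> D \<Longrightarrow> Y \<in> Tree \<Longrightarrow> X \<subseteq> Y \<Longrightarrow> Y \<in> D"
  obtains \<alpha> where "\<alpha> < \<kappa>" "T \<alpha> \<subseteq> D"
proof -
  have "\<exists>\<beta><\<kappa>. \<forall>X\<in>T \<gamma>. \<exists>\<delta>\<le>\<beta>. \<exists>Y\<in>D \<inter> T \<delta>. X \<subseteq> Y \<and> e Y \<le> \<beta>" if "\<gamma> < \<kappa>" for \<gamma>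
    using dense_bound[OF D that] by metis
  then obtain h where h: "\<And>\<gamma>. \<gamma> < \<kappa> \<Longrightarrow> h \<gamma> < \<kappa>"
    "\<And>\<gamma> X. \<gamma> < \<kappa> \<Longrightarrow> X \<in> T \<gamma> \<Longrightarrow> \<exists>\<delta>\<le>h \<gamma>. \<exists>Y\<in>D \<inter> T \<delta>. X \<subseteq> Y \<and> e Y \<le> h \<gamma>"
    by metis
  have eD: "e ` D \<subseteq> {..<\<kappa>}" using D(1) e_less by (auto elim!: TreeE dest!: subsetD)
  define B where "B = {\<beta>. \<beta> < \<kappa> \<and> (\<forall>\<gamma><\<beta>. h \<gamma> < \<beta>) \<and> e ` D \<inter> {..<\<beta>} = Z \<beta>}"
  have cof: "cofinal_in \<kappa> B"
    unfolding cofinal_in_def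
  proof (intro conjI allI impI)
    show "B \<subseteq> {..<\<kappa>}" unfolding B_def by blast
    fix \<alpha> assume "\<alpha> < \<kappa>"
    with guesses[OF eD] h(1)
    obtain \<beta> where "\<beta> \<in> {\<alpha>. \<alpha> < \<kappa> \<and> e ` D \<inter> {..<\<alpha>} = Z \<alpha>}" "\<alpha> < \<beta>" "\<And>\<gamma>. \<gamma> < \<beta> \<Longrightarrow> h \<gamma> < \<beta>"
      by (rule stationary_closure_point) blast+
    then show "\<exists>\<beta>\<in>B. \<alpha> \<le> \<beta>" unfolding B_def by (auto intro!: bexI[of _ \<beta>])
  qed
  have pos: "ozero < \<kappa>"
    using infinite_kappa ozero_le by (metis all_not_in_conv finite.emptyI le_less_trans lessThan_iff)
  obtain \<alpha> where "\<alpha> \<in> {\<alpha>. \<alpha> < \<kappa> \<and> (\<forall>C\<in>\<C> \<alpha>. osup (nacc C \<inter> B) = \<alpha>)}" "limit_ord \<alpha>"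
    by (rule stationary_closure_point[OF hits[OF cof] _ pos, of "\<lambda>\<gamma>. \<gamma>"]) blast+
  then have \<alpha>: "\<alpha> < \<kappa>" "limit_ord \<alpha>" "\<And>C. C \<in> \<C> \<alpha> \<Longrightarrow> osup (nacc C \<inter> B) = \<alpha>"
    by blast+
  have dense: "\<exists>\<delta>\<le>\<beta>. \<exists>a\<in>T \<delta> \<inter> \<Omega> \<beta>. X \<subseteq> a" if \<eta>: "\<beta> \<in> B" "\<eta> < \<beta>" "X \<in> T \<eta>" for \<beta> \<eta> X
  proof -
    have \<beta>: "\<beta> < \<kappa>" "h \<eta> < \<beta>" "e ` D \<inter> {..<\<beta>} = Z \<beta>" using \<eta> unfolding B_def by auto
    have "\<eta> < \<kappa>" using \<eta>(2) \<beta>(1) by simp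
    from h(2)[OF this \<eta>(3)] obtain \<delta> Y where Y: "\<delta> \<le> h \<eta>" "Y \<in> D" "Y \<in> T \<delta>" "X \<subseteq> Y" "e Y \<le> h \<eta>"
      by blast
    \<comment> \<open>Closure under \<open>h\<close> puts both height and code of \<open>Y\<close>
      below \<open>\<beta>\<close>, so the guess at \<open>\<beta>\<close> contains
      \<open>Y\<close>.\<close>
    have "\<delta> < \<beta>" "e Y < \<beta>" using Y(1,5) \<beta>(2) by auto
    moreover have "\<delta> < \<kappa>" using \<open>\<delta> < \<beta>\<close> \<beta>(1) by simp
    moreover have "e Y \<in> Z \<beta>" using \<open>e Y < \<beta>\<close> Y(2) \<beta>(3) by blast
    ultimately have "Y \<in> \<Omega> \<beta>" using T_node Y(3) unfolding \<Omega> by blast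
    then show ?thesis using Y(3,4) less_imp_le[OF \<open>\<delta> < \<beta>\<close>] by blast
  qed
  have "T \<alpha> \<subseteq> D"
  proof
    fix Y assume Y: "Y \<in> T \<alpha>"
    have "\<exists>\<beta>\<in>B. \<exists>a\<in>\<Omega> \<beta>. a \<subseteq> Y" using \<alpha> dense Y by (intro T_limit_meets)
    then obtain \<beta> a where a: "\<beta> \<in> B" "a \<in> \<Omega> \<beta>" "a \<subseteq> Y" by blast
    have "e ` D \<inter> {..<\<beta>} = Z \<beta>" using a(1) unfolding B_def by blast
    moreover have "e a \<in> Z \<beta>" using a(2) unfolding \<Omega> by blast
    ultimately have "e a \<in> e ` D" by blast
    then obtain d where d: "d \<in> D" "e a = e d" by blast
    then have "d \<in> Tree" using D(1) by blast
    then have "\<exists>\<delta><\<kappa>. node \<delta> d" by (auto elim: TreeE)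
    moreover have "\<exists>\<delta><\<kappa>. node \<delta> a" using a(2) unfolding \<Omega> by blast
    \<comment> \<open>\<open>a\<close> is known only to be a node, not yet to be in
      \<open>Tree\<close>, hence injectivity on all nodes.\<close>
    ultimately have "a = d" by (intro inj_onD[OF e_inj d(2)]) simp_all
    then show "Y \<in> D" using up d(1) a(3) TreeI[OF \<alpha>(1) Y] by blast
  qed
  then show thesis using that \<alpha>(1) by blast
qed

text \<open>No maximal antichain is needed: the nodes that extend an element of \<open>A\<close> or are incomparable with
  every element of \<open>A\<close> already form a dense set.\<close>

lemma antichain_small:
  assumes "antichain_in R A"
  shows "|A| <o ord_rel \<kappa>"
proof -
  define B where "B = {X \<in> Tree. e X \<in> A}"
  have A: "A = e ` B" using assms unfolding antichain_in_def Field_R B_def by blast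
  have BT: "B \<subseteq> Tree" unfolding B_def by blast
  have anti: "X = Y" if "X \<in> B" "Y \<in> B" "X \<subseteq> Y" for X Y
  proof -
    have XY: "X \<in> Tree" "Y \<in> Tree" using that BT by blast+
    then have "(e X, e Y) \<in> R" using that by (simp add: R_iff)
    then have "e X = e Y" using assms that unfolding antichain_in_def B_def by blast
    then show ?thesis using XY by (simp add: e_eq)
  qed
  define D where "D = {Y \<in> Tree. (\<exists>a\<in>B. a \<subseteq> Y) \<or> (\<forall>a\<in>B. \<not> Y \<subseteq> a)}"
  obtain \<alpha> where \<alpha>: "\<alpha> < \<kappa>" "T \<alpha> \<subseteq> D"
  proof (rule dense_contains_level[of D])
    show "D \<subseteq> Tree" unfolding D_def by blast
    show "\<exists>Y\<in>D. X \<subseteq> Y" if X: "X \<in> Tree" for X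
    proof (cases "\<exists>a\<in>B. X \<subseteq> a")
      case True
      then obtain a where "a \<in> B" "X \<subseteq> a" by blast
      moreover from this have "a \<in> D" using BT unfolding D_def by blast
      ultimately show ?thesis by blast
    next
      case False
      then have "X \<in> D" using X unfolding D_def by blast
      then show ?thesis by blast
    qed
    show "Y \<in> D" if "X \<in> D" "Y \<in> Tree" "X \<subseteq> Y" for X Y using that unfolding D_def by blast
  qed
  obtain \<beta> where \<beta>: "\<alpha> < \<beta>" "\<beta> < \<kappa>" using next_below_kappa[OF \<alpha>(1)] by blast
  have "B \<subseteq> (\<Union>\<gamma>\<in>{..<\<beta>}. T \<gamma>)"
  proof
    fix a assume a: "a \<in> B"
    then obtain \<gamma> where \<gamma>: "\<gamma> < \<kappa>" "a \<in> T \<gamma>" "node \<gamma> a" using BT TreeE by blast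
    have "\<gamma> \<le> \<alpha>"
    proof (rule ccontr)
      assume "\<not> \<gamma> \<le> \<alpha>"
      then have "below \<alpha> a \<in> T \<alpha>" "node \<alpha> (below \<alpha> a)"
        using T_below[OF \<gamma>(1,2)] node_below[OF \<gamma>(3)] by auto
      \<comment> \<open>The restriction of \<open>a\<close> lies in \<open>D\<close> and below
        \<open>a \<in> B\<close>, which excludes the second alternative in \<open>D\<close>. So it
        extends some \<open>a' \<in> B\<close>, and \<open>a' = a\<close> then contradicts the
        height of \<open>a\<close>.\<close>
      then obtain a' where "a' \<in> B" "a' \<subseteq> below \<alpha> a"
        using \<alpha>(2) a below_subset[of \<alpha> a] unfolding D_def by blast
      moreover from this have "a' = a" using anti a below_subset[of \<alpha> a] by blast
      ultimately show False
        using node_subset_le[OF \<gamma>(3) \<open>node \<alpha> (below \<alpha> a)\<close>] \<open>\<not> \<gamma> \<le> \<alpha>\<close> by blast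
    qed
    then show "a \<in> (\<Union>\<gamma>\<in>{..<\<beta>}. T \<gamma>)" using \<gamma>(2) \<beta>(1) by auto
  qed
  moreover have "|\<Union>\<gamma>\<in>{..<\<beta>}. T \<gamma>| <o ord_rel \<kappa>"
    using \<beta>(2) by (intro UN_less card_below_less T_small) auto
  ultimately have "|B| <o ord_rel \<kappa>" using card_of_mono1 ordLeq_ordLess_trans by blast
  then show ?thesis unfolding A using card_of_image ordLeq_ordLess_trans by blast
qed

text \<open>The siblings of the nodes of a cofinal branch form an antichain of size \<open>\<kappa>\<close>.\<close>

lemma no_cofinal_branch: "\<not> cofinal_branch \<kappa> R B"
proof
  assume B: "cofinal_branch \<kappa> R B"
  have "\<exists>X\<in>T \<alpha>. e X \<in> B" if "\<alpha> < \<kappa>" for \<alpha>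
  proof -
    have "\<alpha> \<in> heights \<kappa> R (Field R)"
      using T_nonempty[OF that] TreeI[OF that] has_height_R[OF that]
      unfolding heights_def Field_R by blast
    then obtain t where t: "t \<in> B" "has_height R t \<alpha>"
      using B unfolding cofinal_branch_def heights_def by blast
    then obtain X where X: "X \<in> Tree" "t = e X" using B unfolding cofinal_branch_def Field_R by blast
    then obtain \<beta> where "\<beta> < \<kappa>" "X \<in> T \<beta>" using TreeE by blast
    then show ?thesis using has_height_R[of \<beta> X \<alpha>] t X by auto
  qed
  then obtain X where X: "\<And>\<alpha>. \<alpha> < \<kappa> \<Longrightarrow> X \<alpha> \<in> T \<alpha>" "\<And>\<alpha>. \<alpha> < \<kappa> \<Longrightarrow> e (X \<alpha>) \<in> B" by metis
  have nX: "node \<alpha> (X \<alpha>)" "X \<alpha> \<in> Tree" if "\<alpha> < \<kappa>" for \<alpha>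
    using T_node TreeI X(1) that by blast+
  have mono: "X \<alpha> \<subseteq> X \<beta>" if "\<alpha> \<le> \<beta>" "\<beta> < \<kappa>" for \<alpha> \<beta>
  proof -
    have "\<alpha> < \<kappa>" using that by simp
    then have "(e (X \<alpha>), e (X \<beta>)) \<in> R \<or> (e (X \<beta>), e (X \<alpha>)) \<in> R"
      using B X(2) that(2) unfolding cofinal_branch_def Chains_def by blast
    then have "X \<alpha> \<subseteq> X \<beta> \<or> X \<beta> \<subseteq> X \<alpha>" using nX \<open>\<alpha> < \<kappa>\<close> that(2) by (simp add: R_iff)
    then show ?thesis
      using node_subset_le[OF nX(1) nX(1), of \<beta> \<alpha>] \<open>\<alpha> < \<kappa>\<close> that by (metis antisym order_refl)
  qed
  have "\<exists>\<beta>. \<alpha> < \<beta> \<and> \<beta> < \<kappa> \<and> osup {..<\<beta>} = \<alpha>" if "\<alpha> < \<kappa>" for \<alpha>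
    using next_below_kappa[OF that] by blast
  then obtain s where s: "\<And>\<alpha>. \<alpha> < \<kappa> \<Longrightarrow> \<alpha> < s \<alpha> \<and> s \<alpha> < \<kappa> \<and> osup {..<s \<alpha>} = \<alpha>"
    by metis
  have T_s: "T (s \<alpha>) = (\<Union>b. insert (\<alpha>, b) ` T \<alpha>)" if "\<alpha> < \<kappa>" for \<alpha>
    using T_succ[of "s \<alpha>"] s[OF that] by simp
  have "\<exists>b. (\<alpha>, b) \<in> X (s \<alpha>)" if "\<alpha> < \<kappa>" for \<alpha>
    using X(1)[of "s \<alpha>"] s[OF that] T_s[OF that] by blast
  then obtain b where b: "\<And>\<alpha>. \<alpha> < \<kappa> \<Longrightarrow> (\<alpha>, b \<alpha>) \<in> X (s \<alpha>)" by metis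
  \<comment> \<open>\<open>V \<alpha>\<close> follows the branch below \<open>\<alpha>\<close> and
    takes the opposite value at \<open>\<alpha>\<close>; successor levels admit both values.\<close>
  define V where "V \<alpha> = insert (\<alpha>, \<not> b \<alpha>) (X \<alpha>)" for \<alpha>
  have V: "V \<alpha> \<in> T (s \<alpha>)" "V \<alpha> \<in> Tree" "node (s \<alpha>) (V \<alpha>)" if "\<alpha> < \<kappa>" for \<alpha>
  proof -
    show "V \<alpha> \<in> T (s \<alpha>)" unfolding T_s[OF that] V_def using X(1)[OF that] by blast
    then show "V \<alpha> \<in> Tree" "node (s \<alpha>) (V \<alpha>)" using s[OF that] TreeI T_node by blast+
  qed
  have incomparable: "\<not> V \<alpha> \<subseteq> V \<beta>" if lt: "\<alpha> < \<kappa>" "\<beta> < \<kappa>" "\<alpha> \<noteq> \<beta>" for \<alpha> \<beta>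
  proof
    assume sub: "V \<alpha> \<subseteq> V \<beta>"
    have s_le: "s \<gamma> \<le> \<delta>" if "\<gamma> < \<delta>" "\<gamma> < \<kappa>" for \<gamma> \<delta>
      using less_iff_le_osup_below[of "s \<gamma>" \<delta>] s[OF that(2)] that(1) by (metis not_le)
    show False
    proof (cases "\<alpha> < \<beta>")
      case True
      \<comment> \<open>As \<open>s \<alpha> \<le> \<beta>\<close>, the branch node
        \<open>X \<beta>\<close> would take both values at \<open>\<alpha>\<close>.\<close>
      have "(\<alpha>, \<not> b \<alpha>) \<in> X \<beta>" using sub lt(3) unfolding V_def by blast
      moreover have "(\<alpha>, b \<alpha>) \<in> X \<beta>" using b[OF lt(1)] mono[OF s_le[OF True lt(1)] lt(2)] by blast
      ultimately show False using nX(1)[OF lt(2)] unfolding node_def single_valued_def by metis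
    next
      case False
      \<comment> \<open>Now heights decide: \<open>V \<beta>\<close> has height at most
        \<open>\<alpha>\<close>, while \<open>V \<alpha>\<close> has height
        \<open>s \<alpha> > \<alpha>\<close>.\<close>
      then have "s \<beta> \<le> \<alpha>" using s_le lt by simp
      moreover have "s \<alpha> \<le> s \<beta>" using node_subset_le[OF V(3)[OF lt(1)] V(3)[OF lt(2)] sub] .
      ultimately show False using s[OF lt(1)] by (meson leD le_less_trans)
    qed
  qed
  have "inj_on (\<lambda>\<alpha>. e (V \<alpha>)) {..<\<kappa>}"
    using incomparable V(2) by (intro inj_onI) (auto simp: e_eq)
  then have "|{..<\<kappa>}| \<le>o |(\<lambda>\<alpha>. e (V \<alpha>)) ` {..<\<kappa>}|"
    using card_of_ordLeq by blast
  moreover have "antichain_in R ((\<lambda>\<alpha>. e (V \<alpha>)) ` {..<\<kappa>})"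
    unfolding antichain_in_def Field_R using V(2) incomparable by (auto simp: R_iff)
  ultimately have "|{..<\<kappa>}| <o ord_rel \<kappa>" using antichain_small ordLeq_ordLess_trans by blast
  then show False using card_below_kappa not_ordLess_ordIso by blast
qed

lemma souslin_tree_R: "souslin_tree \<kappa> R"
  unfolding souslin_tree_def aronszajn_tree_def
  using kappa_tree_R no_cofinal_branch antichain_small not_ordLess_ordIso by blast

end

theorem propositionA:
  fixes \<kappa> :: "'a::wellorder"
  assumes "regular_uncountable \<kappa>"
    and "boxtimes_star \<kappa>"
    and "diamond \<kappa>"
  shows "\<exists>R :: 'a rel. souslin_tree \<kappa> R"
proof -
  interpret regular \<kappa> by (unfold_locales) fact
  obtain \<C> :: "'a \<Rightarrow> 'a set set" where C:
    "\<And>\<alpha>. \<alpha> < \<kappa> \<Longrightarrow> limit_ord \<alpha> \<Longrightarrow> \<C> \<alpha> \<noteq> {} \<and> (\<forall>C\<in>\<C> \<alpha>. club_in \<alpha> C) \<and> |\<C> \<alpha>| <o ord_rel \<kappa> \<and>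
        (\<forall>C\<in>\<C> \<alpha>. \<forall>\<beta>\<in>acc C. C \<inter> {..<\<beta>} \<in> \<C> \<beta>)"
    "\<And>A. cofinal_in \<kappa> A \<Longrightarrow>
        stationary_in \<kappa> {\<alpha>. \<alpha> < \<kappa> \<and> (\<forall>C\<in>\<C> \<alpha>. osup (nacc C \<inter> A) = \<alpha>)}"
    using assms(2) unfolding boxtimes_star_def by blast
  obtain Z :: "'a \<Rightarrow> 'a set" where Z:
    "\<And>X. X \<subseteq> {..<\<kappa>} \<Longrightarrow> stationary_in \<kappa> {\<alpha>. \<alpha> < \<kappa> \<and> X \<inter> {..<\<alpha>} = Z \<alpha>}"
    using assms(3) unfolding diamond_def by blast
  obtain e :: "('a \<times> bool) set \<Rightarrow> 'a" where e: "inj_on e {X. \<exists>\<alpha><\<kappa>. node \<alpha> X}"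
    "\<And>\<alpha> X. \<alpha> < \<kappa> \<Longrightarrow> node \<alpha> X \<Longrightarrow> e X < \<kappa>"
    using node_coding[OF Z] by blast
  \<comment> \<open>\<open>\<Omega>\<close> is chosen as the pull-back of \<open>Z\<close> along
    \<open>e\<close>, so its locale equation is trivial.\<close>
  interpret coded_levels \<kappa> \<C> "\<lambda>\<beta>. {X. (\<exists>\<alpha><\<kappa>. node \<alpha> X) \<and> e X \<in> Z \<beta>}" Z e
    by unfold_locales (use C Z e in auto)
  show ?thesis using souslin_tree_R by blast
qed

end
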